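(* Let $p\le q$ be positive integers, $f=x^p+y^q\in\mathbb C[x,y]$ and $\ell\in\mathbb Z_{<0}$. Then for every $\omega=(\omega_1,\omega_2)\in\mathbb R^2\setminus\{0\}$, $$b_{\mathrm{Ann}(f^\ell),\omega}(s)=\begin{cases}(s-\ell q\omega_2)\displaystyle\prod_{i=1}^{q-1}\Big(s-\big(\ell p+\tfrac pq i\big)\omega_1+i\omega_2\Big)&\text{if }p\omega_1>q\omega_2,\\[2mm] (s-\ell p\omega_1)\displaystyle\prod_{i=1}^{p-1}\Big(s+i\omega_1-\big(\ell q+\tfrac qp i\big)\omega_2\Big)&\text{if }p\omega_1<q\omega_2,\\[2mm] s-\ell p\omega_1&\text{if }p\omega_1=q\omega_2.\end{cases}$$ In particular these b-functions have no multiple roots.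
   Context: $D_2$ is the second Weyl algebra in $x,y,\partial_x,\partial_y$; ideals are left ideals. For $\omega\in\mathbb R^2$, the $(-\omega,\omega)$-weight of $x^{a}y^{b}\partial_x^{c}\partial_y^{e}$ is $-\omega_1a-\omega_2b+\omega_1c+\omega_2e$; $\mathrm{in}_{(-\omega,\omega)}(I)$ is the left ideal generated by the maximal-weight parts of the (normally ordered) elements of $I$. For a holonomic ideal $I$ and $\omega\neq0$, with $s=\omega_1x\partial_x+\omega_2y\partial_y$, the b-function $b_{I,\omega}(s)$ is the monic generator of $\mathrm{in}_{(-\omega,\omega)}(I)\cap\mathbb C[s]$. $\mathrm{Ann}(f^\ell)=\{P\in D_2:P\bullet f^\ell=0\}$ with $x\bullet g=xg$, $\partial_x\bullet g=\partial g/\partial x$, etc. *)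

theory Defs
  imports "HOL-Analysis.Analysis" "HOL-Computational_Algebra.Polynomial"
begin

text \<open>Elements of the second Weyl algebra D_2 in normally ordered form:
  a finitely supported coefficient function on exponent tuples (a,b,c,e),
  standing for the sum of coefficients times x^a y^b dx^c dy^e.\<close>

type_synonym mono4 = "nat \<times> nat \<times> nat \<times> nat"
type_synonym weyl = "mono4 \<Rightarrow> complex"

definition wsupp :: "weyl \<Rightarrow> mono4 set" where
  "wsupp P = {m. P m \<noteq> 0}"

definition weyl_elems :: "weyl set" where
  "weyl_elems = {P. finite (wsupp P)}"

definition wzero :: weyl where "wzero = (\<lambda>_. 0)"

definition wadd :: "weyl \<Rightarrow> weyl \<Rightarrow> weyl" where
  "wadd P Q = (\<lambda>m. P m + Q m)"

text \<open>Coefficient of the normally ordered monomial n in the product of the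
  monomials m1 * m2 (Leibniz rule: dx^c x^a' = sum_k C(c,k) a'!/(a'-k)! x^(a'-k) dx^(c-k)).\<close>
definition monprod :: "mono4 \<Rightarrow> mono4 \<Rightarrow> mono4 \<Rightarrow> complex" where
  "monprod m1 m2 n = (case m1 of (a,b,c,e) \<Rightarrow> case m2 of (a',b',c',e') \<Rightarrow>
     (\<Sum>k\<in>{..min c a'}. \<Sum>j\<in>{..min e b'}.
        if n = (a + a' - k, b + b' - j, c + c' - k, e + e' - j)
        then of_nat ((c choose k) * (fact a' div fact (a' - k))
                     * (e choose j) * (fact b' div fact (b' - j)))
        else 0))"

definition wmult :: "weyl \<Rightarrow> weyl \<Rightarrow> weyl" where
  "wmult P Q = (\<lambda>n. \<Sum>m1\<in>wsupp P. \<Sum>m2\<in>wsupp Q. P m1 * Q m2 * monprod m1 m2 n)"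

definition wone :: weyl where
  "wone = (\<lambda>m. if m = (0,0,0,0) then 1 else 0)"

primrec wpow :: "weyl \<Rightarrow> nat \<Rightarrow> weyl" where
  "wpow P 0 = wone"
| "wpow P (Suc n) = wmult P (wpow P n)"

inductive_set left_ideal_gen :: "weyl set \<Rightarrow> weyl set" for G where
  zero: "wzero \<in> left_ideal_gen G"
| gen: "g \<in> G \<Longrightarrow> g \<in> left_ideal_gen G"
| add: "P \<in> left_ideal_gen G \<Longrightarrow> Q \<in> left_ideal_gen G \<Longrightarrow> wadd P Q \<in> left_ideal_gen G"
| lmult: "A \<in> weyl_elems \<Longrightarrow> P \<in> left_ideal_gen G \<Longrightarrow> wmult A P \<in> left_ideal_gen G"

definition wt :: "real \<times> real \<Rightarrow> mono4 \<Rightarrow> real" where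
  "wt \<omega> m = (case m of (a,b,c,e) \<Rightarrow>
     - fst \<omega> * real a - snd \<omega> * real b + fst \<omega> * real c + snd \<omega> * real e)"

definition winit :: "real \<times> real \<Rightarrow> weyl \<Rightarrow> weyl" where
  "winit \<omega> P = (\<lambda>m. if m \<in> wsupp P \<and> wt \<omega> m = Max (wt \<omega> ` wsupp P) then P m else 0)"

definition init_ideal :: "real \<times> real \<Rightarrow> weyl set \<Rightarrow> weyl set" where
  "init_ideal \<omega> I = left_ideal_gen (winit \<omega> ` I)"

definition s_op :: "real \<times> real \<Rightarrow> weyl" where
  "s_op \<omega> = (\<lambda>m. if m = (1,0,1,0) then complex_of_real (fst \<omega>)
                 else if m = (0,1,0,1) then complex_of_real (snd \<omega>) else 0)"

definition weyl_of_poly :: "real \<times> real \<Rightarrow> complex poly \<Rightarrow> weyl" where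
  "weyl_of_poly \<omega> g = (\<lambda>m. \<Sum>i\<le>degree g. coeff g i * wpow (s_op \<omega>) i m)"

text \<open>b is the b-function of I w.r.t. omega: the monic generator of
  in_(-omega,omega)(I) intersected with C[s].\<close>
definition is_bfunction :: "weyl set \<Rightarrow> real \<times> real \<Rightarrow> complex poly \<Rightarrow> bool" where
  "is_bfunction I \<omega> b \<longleftrightarrow> lead_coeff b = 1 \<and>
     (\<forall>g. weyl_of_poly \<omega> g \<in> init_ideal \<omega> I \<longleftrightarrow> b dvd g)"

definition pdx :: "(complex \<times> complex \<Rightarrow> complex) \<Rightarrow> complex \<times> complex \<Rightarrow> complex" where
  "pdx g = (\<lambda>(x,y). deriv (\<lambda>t. g (t,y)) x)"

definition pdy :: "(complex \<times> complex \<Rightarrow> complex) \<Rightarrow> complex \<times> complex \<Rightarrow> complex" where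
  "pdy g = (\<lambda>(x,y). deriv (\<lambda>t. g (x,t)) y)"

definition wact :: "weyl \<Rightarrow> (complex \<times> complex \<Rightarrow> complex) \<Rightarrow> complex \<times> complex \<Rightarrow> complex" where
  "wact P g = (\<lambda>z. \<Sum>m\<in>wsupp P. case m of (a,b,c,e) \<Rightarrow>
      P m * fst z ^ a * snd z ^ b * ((pdx ^^ c) ((pdy ^^ e) g)) z)"

definition Ann_on :: "(complex \<times> complex) set \<Rightarrow> (complex \<times> complex \<Rightarrow> complex) \<Rightarrow> weyl set" where
  "Ann_on U g = {P \<in> weyl_elems. \<forall>z\<in>U. wact P g z = 0}"

definition fpow :: "nat \<Rightarrow> nat \<Rightarrow> int \<Rightarrow> complex \<times> complex \<Rightarrow> complex" where
  "fpow p q l = (\<lambda>(x,y). (x ^ p + y ^ q) powi l)"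

definition fnonzero :: "nat \<Rightarrow> nat \<Rightarrow> (complex \<times> complex) set" where
  "fnonzero p q = {(x,y). x ^ p + y ^ q \<noteq> 0}"

definition Ann_fpow :: "nat \<Rightarrow> nat \<Rightarrow> int \<Rightarrow> weyl set" where
  "Ann_fpow p q l = Ann_on (fnonzero p q) (fpow p q l)"

end

theory Submission
  imports Defs
begin

text \<open>
  Put \<open>l = -(n+1)\<close> and \<open>f = x\<^sup>p + y\<^sup>q\<close>, and let operators act on arbitrary formal sums of monomials
  \<open>x\<^sup>\<alpha> y\<^sup>\<beta>\<close> with complex exponents.

  Upper bound. The annihilator contains the Euler operator
  \<open>E = q x \<partial>\<^sub>x + p y \<partial>\<^sub>y - l p q\<close> and \<open>T = q y\<^bsup>q-1\<^esup> \<partial>\<^sub>x - p x\<^bsup>p-1\<^esup> \<partial>\<^sub>y\<close>. If \<open>p \<omega>\<^sub>1 > q \<omega>\<^sub>2\<close>, the initial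
  form of \<open>T\<close> is \<open>q y\<^bsup>q-1\<^esup> \<partial>\<^sub>x\<close>, and multiplying by \<open>x \<partial>\<^sub>y\<^bsup>q-1\<^esup>\<close> gives \<open>x \<partial>\<^sub>x\<close> times the product of the
  \<open>y \<partial>\<^sub>y + i\<close>, \<open>1 \<le> i < q\<close>. Modulo \<open>E\<close>, the factors \<open>x \<partial>\<^sub>x\<close> and \<open>y \<partial>\<^sub>y + i\<close> become multiples of the linear
  factors of the b-function.

  Lower bound. The binomial coefficients of the expansion of \<open>f\<^sup>l\<close> are, up to sign, values of a
  polynomial, so the expansion can be shifted: for every \<open>t\<close> an annihilator of \<open>f\<^sup>l\<close> also kills a
  formal series supported on exponents \<open>(p (t+k), q (l-t-k))\<close>, \<open>k\<close> an integer. Sums of monomials whose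
  \<open>y\<close>-exponent is not a negative integer form a submodule. For \<open>t = l + i/q\<close> the shifted series has a
  single extremal monomial modulo this submodule, namely \<open>x\<^bsup>pt\<^esup> y\<^bsup>-i\<^esup>\<close>; it is killed by the initial
  ideal, and \<open>s\<close> acts on it by the \<open>i\<close>-th root.

  The case \<open>p \<omega>\<^sub>1 < q \<omega>\<^sub>2\<close> follows by exchanging \<open>x\<close> and \<open>y\<close>.
\<close>

section \<open>Action of the Weyl algebra on formal sums of monomials\<close>

text \<open>A formal sum is given by its coefficient at each pair of exponents; \<open>\<alpha>\<close> and \<open>\<beta>\<close> below are the
  exponents of the result, not of the argument.\<close>
type_synonym formal = "complex \<Rightarrow> complex \<Rightarrow> complex"

text \<open>Applying \<open>dx^c\<close> to a power of \<open>x\<close> gives a falling factorial of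
  the old exponent; in terms of the new exponent this is the rising factorial
  \<open>pochhammer (\<alpha> - a + 1) c\<close>.\<close>

definition mop :: "mono4 \<Rightarrow> formal \<Rightarrow> formal" where
  "mop m F \<alpha> \<beta> = (case m of (a,b,c,e) \<Rightarrow>
     pochhammer (\<alpha> - of_nat a + 1) c * pochhammer (\<beta> - of_nat b + 1) e *
     F (\<alpha> - of_nat a + of_nat c) (\<beta> - of_nat b + of_nat e))"

definition wop :: "weyl \<Rightarrow> formal \<Rightarrow> formal" where
  "wop P F \<alpha> \<beta> = (\<Sum>m\<in>wsupp P. P m * mop m F \<alpha> \<beta>)"

lemma wop_superset:
  assumes "finite S" "wsupp P \<subseteq> S"
  shows "wop P F \<alpha> \<beta> = (\<Sum>m\<in>S. P m * mop m F \<alpha> \<beta>)"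
  unfolding wop_def using assms by (intro sum.mono_neutral_left) (auto simp: wsupp_def)

lemma wzero_elems: "wzero \<in> weyl_elems"
  by (simp add: weyl_elems_def wsupp_def wzero_def)

lemma wop_wzero: "wop wzero F \<alpha> \<beta> = 0"
  by (simp add: wop_def wsupp_def wzero_def)

lemma wadd_elems:
  assumes "P \<in> weyl_elems" "Q \<in> weyl_elems"
  shows "wadd P Q \<in> weyl_elems"
proof -
  have "wsupp (wadd P Q) \<subseteq> wsupp P \<union> wsupp Q"
    by (auto simp: wsupp_def wadd_def)
  then show ?thesis using assms by (auto simp: weyl_elems_def intro: finite_subset)
qed

lemma wop_wadd:
  assumes "P \<in> weyl_elems" "Q \<in> weyl_elems"
  shows "wop (wadd P Q) F \<alpha> \<beta> = wop P F \<alpha> \<beta> + wop Q F \<alpha> \<beta>"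
proof -
  let ?S = "wsupp P \<union> wsupp Q"
  have fin: "finite ?S" using assms by (auto simp: weyl_elems_def)
  have sub: "wsupp (wadd P Q) \<subseteq> ?S"
    by (auto simp: wsupp_def wadd_def)
  show ?thesis
    unfolding wop_superset[OF fin sub] wop_superset[OF fin Un_upper1] wop_superset[OF fin Un_upper2]
    by (simp add: wadd_def sum.distrib algebra_simps)
qed

section \<open>Normal ordering and composition of operators\<close>

lemma pochhammer_conv_gbinomial:
  "pochhammer (z::complex) n = fact n * ((z + of_nat n - 1) gchoose n)"
  by (simp add: gbinomial_pochhammer')

lemma fact_div_eq_gbinomial:
  assumes "k \<le> a"
  shows "(of_nat (fact a div fact (a - k)) :: complex) = fact k * (of_nat a gchoose k)"
proof -
  have "(of_nat (fact a div fact (a - k)) :: complex) = fact a / fact (a - k)"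
  proof -
    obtain d :: nat where d: "fact a = fact (a - k) * d"
      using fact_dvd[of "a - k" a] by (auto elim: dvdE)
    then have "(fact a :: complex) = fact (a - k) * of_nat d"
      by (metis of_nat_fact of_nat_mult)
    with d show ?thesis by simp
  qed
  also have "\<dots> = fact k * of_nat (a choose k)"
    using assms by (simp add: binomial_fact)
  finally show ?thesis by (simp add: binomial_gbinomial)
qed

text \<open>After division by \<open>c!\<close> this is the Chu-Vandermonde convolution for
  \<open>(a + z) gchoose c\<close> with \<open>z = w + c - 1 - a\<close>; the terms with
  \<open>k > a\<close> vanish, so the sum may stop at \<open>min c a\<close>.\<close>

lemma pochhammer_Vandermonde:
  "pochhammer (w::complex) c = (\<Sum>k\<le>min c a.
     of_nat ((c choose k) * (fact a div fact (a - k))) * pochhammer (w - of_nat a + of_nat k) (c - k))"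
proof -
  define z where "z = w + of_nat c - 1 - of_nat a"
  have "(\<Sum>k\<le>min c a. of_nat ((c choose k) * (fact a div fact (a - k))) * pochhammer (w - of_nat a + of_nat k) (c - k))
     = (\<Sum>k\<le>min c a. fact c * ((of_nat a gchoose k) * (z gchoose (c - k))))"
  proof (rule sum.cong[OF refl])
    fix k assume "k \<in> {..min c a}"
    then have k: "k \<le> c" "k \<le> a" by auto
    have "w - of_nat a + of_nat k + of_nat (c - k) - 1 = z"
      using k by (simp add: z_def of_nat_diff)
    then have "pochhammer (w - of_nat a + of_nat k) (c - k) = fact (c - k) * (z gchoose (c - k))"
      by (simp add: pochhammer_conv_gbinomial)
    moreover have "(of_nat (c choose k) :: complex) * fact k * fact (c - k) = fact c"
      using k by (simp add: binomial_fact)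
    ultimately show "of_nat ((c choose k) * (fact a div fact (a - k))) * pochhammer (w - of_nat a + of_nat k) (c - k)
      = fact c * ((of_nat a gchoose k) * (z gchoose (c - k)))"
      using fact_div_eq_gbinomial[OF k(2)] by (simp add: algebra_simps)
  qed
  also have "\<dots> = (\<Sum>k\<in>{0..c}. fact c * ((of_nat a gchoose k) * (z gchoose (c - k))))"
    by (rule sum.mono_neutral_left) (auto simp: binomial_gbinomial[symmetric])
  also have "\<dots> = fact c * ((of_nat a + z) gchoose c)"
    by (simp add: gbinomial_Vandermonde[symmetric] sum_distrib_left)
  also have "\<dots> = pochhammer w c"
    by (simp add: pochhammer_conv_gbinomial z_def algebra_simps)
  finally show ?thesis ..
qed

text \<open>Normal ordering of \<open>x^a dx^c x^a' dx^c'\<close> in one variable. Each Pochhammer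
  symbol on the right splits off its last \<open>c'\<close> factors, which do not depend on
  \<open>k\<close>; Vandermonde sums the rest.\<close>

lemma pochhammer_mult_reorder:
  fixes u :: complex
  shows "pochhammer (u - of_nat a + 1) c * pochhammer (u - of_nat a + of_nat c - of_nat a' + 1) c' =
   (\<Sum>k\<le>min c a'. of_nat ((c choose k) * (fact a' div fact (a' - k))) *
      pochhammer (u - of_nat (a + a' - k) + 1) (c + c' - k))"
proof -
  have "pochhammer (u - of_nat (a + a' - k) + 1) (c + c' - k) =
      pochhammer (u - of_nat a + 1 - of_nat a' + of_nat k) (c - k) *
      pochhammer (u - of_nat a + of_nat c - of_nat a' + 1) c'" if "k \<le> min c a'" for k
  proof -
    have "u - of_nat (a + a' - k) + 1 = u - of_nat a + 1 - of_nat a' + of_nat k"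
      using that by (simp add: of_nat_diff algebra_simps)
    moreover have "c + c' - k = (c - k) + c'" using that by simp
    moreover have "u - of_nat a + 1 - of_nat a' + of_nat k + of_nat (c - k) =
       u - of_nat a + of_nat c - of_nat a' + 1"
      using that by (simp add: of_nat_diff algebra_simps)
    ultimately show ?thesis by (metis pochhammer_product')
  qed
  then have "(\<Sum>k\<le>min c a'. of_nat ((c choose k) * (fact a' div fact (a' - k))) *
      pochhammer (u - of_nat (a + a' - k) + 1) (c + c' - k)) =
    (\<Sum>k\<le>min c a'. of_nat ((c choose k) * (fact a' div fact (a' - k))) *
      pochhammer (u - of_nat a + 1 - of_nat a' + of_nat k) (c - k)) *
      pochhammer (u - of_nat a + of_nat c - of_nat a' + 1) c'"
    unfolding sum_distrib_right by (intro sum.cong refl) (simp only: atMost_iff mult.assoc)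
  then show ?thesis
    by (simp only: pochhammer_Vandermonde[of "u - of_nat a + 1" c a'])
qed

definition monprod_idx :: "mono4 \<Rightarrow> mono4 \<Rightarrow> mono4 set" where
  "monprod_idx m1 m2 = (case m1 of (a,b,c,e) \<Rightarrow> case m2 of (a',b',c',e') \<Rightarrow>
     (\<lambda>(k,j). (a + a' - k, b + b' - j, c + c' - k, e + e' - j)) ` ({..min c a'} \<times> {..min e b'}))"

lemma finite_monprod_idx: "finite (monprod_idx m1 m2)"
  by (auto simp: monprod_idx_def split: prod.splits)

lemma monprod_eq_0: "n \<notin> monprod_idx m1 m2 \<Longrightarrow> monprod m1 m2 n = 0"
  by (force simp: monprod_idx_def monprod_def split: prod.splits intro!: sum.neutral)

text \<open>Each pair \<open>(k,j)\<close> in \<open>monprod\<close> contributes to a single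
  \<open>n\<close>, so after exchanging the sums the two variables separate and the one-variable
  reordering applies to each.\<close>

lemma mop_mop:
  assumes "finite S" "monprod_idx m1 m2 \<subseteq> S"
  shows "mop m1 (mop m2 F) \<alpha> \<beta> = (\<Sum>n\<in>S. monprod m1 m2 n * mop n F \<alpha> \<beta>)"
proof -
  obtain a b c e where m1: "m1 = (a,b,c,e)" by (cases m1) auto
  obtain a' b' c' e' where m2: "m2 = (a',b',c',e')" by (cases m2) auto
  let ?K = "{..min c a'}" and ?J = "{..min e b'}"
  let ?n = "\<lambda>k j. (a + a' - k, b + b' - j, c + c' - k, e + e' - j)"
  let ?cf = "\<lambda>k j. (of_nat ((c choose k) * (fact a' div fact (a' - k))
                     * (e choose j) * (fact b' div fact (b' - j))) :: complex)"
  let ?F = "F (\<alpha> - of_nat a + of_nat c - of_nat a' + of_nat c') (\<beta> - of_nat b + of_nat e - of_nat b' + of_nat e')"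
  have "(\<Sum>n\<in>S. monprod m1 m2 n * mop n F \<alpha> \<beta>) =
     (\<Sum>n\<in>S. \<Sum>k\<in>?K. \<Sum>j\<in>?J. (if n = ?n k j then ?cf k j else 0) * mop n F \<alpha> \<beta>)"
    by (simp only: m1 m2 monprod_def prod.case sum_distrib_right)
  also have "\<dots> = (\<Sum>k\<in>?K. \<Sum>j\<in>?J. \<Sum>n\<in>S. (if n = ?n k j then ?cf k j else 0) * mop n F \<alpha> \<beta>)"
    by (subst sum.swap, rule sum.cong[OF refl], subst sum.swap) simp
  also have "\<dots> = (\<Sum>k\<in>?K. \<Sum>j\<in>?J. ?cf k j * mop (?n k j) F \<alpha> \<beta>)"
  proof (intro sum.cong refl)
    fix k j assume "k \<in> ?K" "j \<in> ?J"
    then have "?n k j \<in> monprod_idx m1 m2"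
      by (auto simp: monprod_idx_def m1 m2 intro!: image_eqI[of _ _ "(k,j)"])
    then have "?n k j \<in> S" using assms(2) by blast
    have "(\<Sum>n\<in>S. (if n = ?n k j then ?cf k j else 0) * mop n F \<alpha> \<beta>)
       = (\<Sum>n\<in>S. if n = ?n k j then ?cf k j * mop n F \<alpha> \<beta> else 0)"
      by (rule sum.cong) auto
    then show "(\<Sum>n\<in>S. (if n = ?n k j then ?cf k j else 0) * mop n F \<alpha> \<beta>) = ?cf k j * mop (?n k j) F \<alpha> \<beta>"
      using \<open>?n k j \<in> S\<close> assms(1) by (simp del: of_nat_mult)
  qed
  also have "\<dots> = (\<Sum>k\<in>?K. \<Sum>j\<in>?J.
      (of_nat ((c choose k) * (fact a' div fact (a' - k))) * pochhammer (\<alpha> - of_nat (a + a' - k) + 1) (c + c' - k)) *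
      (of_nat ((e choose j) * (fact b' div fact (b' - j))) * pochhammer (\<beta> - of_nat (b + b' - j) + 1) (e + e' - j)) * ?F)"
  proof (intro sum.cong refl)
    fix k j assume k: "k \<in> ?K" and j: "j \<in> ?J"
    have "\<alpha> - of_nat (a + a' - k) + of_nat (c + c' - k) = \<alpha> - of_nat a + of_nat c - of_nat a' + of_nat c'"
      using k by (simp add: of_nat_diff algebra_simps)
    moreover have "\<beta> - of_nat (b + b' - j) + of_nat (e + e' - j) = \<beta> - of_nat b + of_nat e - of_nat b' + of_nat e'"
      using j by (simp add: of_nat_diff algebra_simps)
    ultimately have F: "F (\<alpha> - of_nat (a + a' - k) + of_nat (c + c' - k)) (\<beta> - of_nat (b + b' - j) + of_nat (e + e' - j)) = ?F"
      by (simp only:)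
    show "?cf k j * mop (?n k j) F \<alpha> \<beta> = (of_nat ((c choose k) * (fact a' div fact (a' - k))) * pochhammer (\<alpha> - of_nat (a + a' - k) + 1) (c + c' - k)) *
      (of_nat ((e choose j) * (fact b' div fact (b' - j))) * pochhammer (\<beta> - of_nat (b + b' - j) + 1) (e + e' - j)) * ?F"
      unfolding mop_def prod.case F by simp
  qed
  also have "\<dots> = (pochhammer (\<alpha> - of_nat a + 1) c * pochhammer (\<alpha> - of_nat a + of_nat c - of_nat a' + 1) c') *
      (pochhammer (\<beta> - of_nat b + 1) e * pochhammer (\<beta> - of_nat b + of_nat e - of_nat b' + 1) e') * ?F"
    unfolding pochhammer_mult_reorder sum_product unfolding sum_distrib_right ..
  also have "\<dots> = mop m1 (mop m2 F) \<alpha> \<beta>"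
    by (simp add: mop_def m1 m2)
  finally show ?thesis ..
qed

lemma mop_sum:
  "mop m (\<lambda>\<alpha> \<beta>. \<Sum>i\<in>S. c i * G i \<alpha> \<beta>) \<alpha> \<beta> = (\<Sum>i\<in>S. c i * mop m (G i) \<alpha> \<beta>)"
  by (cases m) (simp add: mop_def sum_distrib_left algebra_simps)

lemma wsupp_wmult: "wsupp (wmult P Q) \<subseteq> (\<Union>m1\<in>wsupp P. \<Union>m2\<in>wsupp Q. monprod_idx m1 m2)"
proof
  fix n assume "n \<in> wsupp (wmult P Q)"
  then have "wmult P Q n \<noteq> 0" by (simp add: wsupp_def)
  then obtain m1 where m1: "m1 \<in> wsupp P" "(\<Sum>m2\<in>wsupp Q. P m1 * Q m2 * monprod m1 m2 n) \<noteq> 0"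
    unfolding wmult_def by (meson sum.not_neutral_contains_not_neutral)
  then obtain m2 where "m2 \<in> wsupp Q" "P m1 * Q m2 * monprod m1 m2 n \<noteq> 0"
    by (meson sum.not_neutral_contains_not_neutral)
  then show "n \<in> (\<Union>m1\<in>wsupp P. \<Union>m2\<in>wsupp Q. monprod_idx m1 m2)"
    using m1 monprod_eq_0 by fastforce
qed

lemma wmult_elems:
  assumes "P \<in> weyl_elems" "Q \<in> weyl_elems"
  shows "wmult P Q \<in> weyl_elems"
  using assms wsupp_wmult[of P Q]
  by (auto simp: weyl_elems_def finite_monprod_idx intro!: finite_subset[OF wsupp_wmult])

text \<open>Bilinear extension of \<open>mop_mop\<close>: formal sums become a left module over the
  Weyl algebra.\<close>

lemma wop_wmult:
  assumes "P \<in> weyl_elems" "Q \<in> weyl_elems"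
  shows "wop (wmult P Q) F = wop P (wop Q F)"
proof (intro ext)
  fix \<alpha> \<beta>
  let ?S = "\<Union>m1\<in>wsupp P. \<Union>m2\<in>wsupp Q. monprod_idx m1 m2"
  have fin: "finite ?S" using assms by (auto simp: weyl_elems_def finite_monprod_idx)
  have "wop (wmult P Q) F \<alpha> \<beta> = (\<Sum>n\<in>?S. \<Sum>m1\<in>wsupp P. \<Sum>m2\<in>wsupp Q. P m1 * Q m2 * (monprod m1 m2 n * mop n F \<alpha> \<beta>))"
    unfolding wop_superset[OF fin wsupp_wmult]
    by (simp add: wmult_def sum_distrib_right mult.assoc)
  also have "\<dots> = (\<Sum>m1\<in>wsupp P. \<Sum>m2\<in>wsupp Q. \<Sum>n\<in>?S. P m1 * Q m2 * (monprod m1 m2 n * mop n F \<alpha> \<beta>))"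
    by (subst sum.swap, rule sum.cong[OF refl], subst sum.swap) simp
  also have "\<dots> = (\<Sum>m1\<in>wsupp P. \<Sum>m2\<in>wsupp Q. P m1 * Q m2 * mop m1 (mop m2 F) \<alpha> \<beta>)"
  proof (intro sum.cong refl)
    fix m1 m2 assume "m1 \<in> wsupp P" "m2 \<in> wsupp Q"
    then have "monprod_idx m1 m2 \<subseteq> ?S" by blast
    then show "(\<Sum>n\<in>?S. P m1 * Q m2 * (monprod m1 m2 n * mop n F \<alpha> \<beta>)) = P m1 * Q m2 * mop m1 (mop m2 F) \<alpha> \<beta>"
      by (simp add: mop_mop[OF fin] sum_distrib_left)
  qed
  also have "\<dots> = (\<Sum>m1\<in>wsupp P. P m1 * mop m1 (wop Q F) \<alpha> \<beta>)"
  proof (intro sum.cong refl)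
    fix m1
    have "wop Q F = (\<lambda>\<alpha> \<beta>. \<Sum>m2\<in>wsupp Q. Q m2 * mop m2 F \<alpha> \<beta>)"
      by (intro ext) (simp add: wop_def)
    then show "(\<Sum>m2\<in>wsupp Q. P m1 * Q m2 * mop m1 (mop m2 F) \<alpha> \<beta>) = P m1 * mop m1 (wop Q F) \<alpha> \<beta>"
      by (simp add: mop_sum sum_distrib_left mult.assoc)
  qed
  finally show "wop (wmult P Q) F \<alpha> \<beta> = wop P (wop Q F) \<alpha> \<beta>" by (simp add: wop_def)
qed

text \<open>The factors \<open>i, ..., i + c - 1\<close> include zero.\<close>

lemma pochhammer_neg_int_eq_0:
  assumes "i \<le> 0" "0 < i + int c"
  shows "pochhammer (of_int i :: complex) c = 0"
proof -
  have "(of_int i :: complex) = - of_nat (nat (- i))" using assms by simp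
  moreover have "nat (- i) < c" using assms by linarith
  ultimately show ?thesis by (metis pochhammer_of_nat_eq_0_iff)
qed

lemma wop_eq_0_imp_zero:
  assumes P: "P \<in> weyl_elems" and 0: "\<And>F \<alpha> \<beta>. wop P F \<alpha> \<beta> = 0"
  shows "P = wzero"
proof (rule ccontr)
  assume "P \<noteq> wzero"
  then have "wsupp P \<noteq> {}" by (auto simp: wzero_def wsupp_def fun_eq_iff)
  moreover have fin: "finite (wsupp P)" using P by (simp add: weyl_elems_def)
  ultimately obtain m where m: "m \<in> wsupp P"
    and min: "\<And>m'. m' \<in> wsupp P \<Longrightarrow> (case m of (a,b,c,e) \<Rightarrow> c + e) \<le> (case m' of (a,b,c,e) \<Rightarrow> c + e)"
    using ex_min_if_finite[of "(\<lambda>(a,b,c,e). c + e) ` wsupp P"]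
    by (fastforce simp: not_less)
  obtain a b c e where m': "m = (a,b,c,e)" by (cases m) auto
  text \<open>Apply \<open>P\<close> to the monomial \<open>x\<^sup>c y\<^sup>e\<close>: by minimality only derivatives of bidegree
    \<open>(c, e)\<close> survive.\<close>
  define F :: formal where "F = (\<lambda>\<alpha> \<beta>. if \<alpha> = of_nat c \<and> \<beta> = of_nat e then 1 else 0)"
  have "P n * mop n F (of_nat a) (of_nat b) = 0" if n: "n \<in> wsupp P" "n \<noteq> m" for n
  proof -
    obtain a' b' c' e' where n': "n = (a',b',c',e')" by (cases n) auto
    show ?thesis
    proof (rule ccontr)
      assume "P n * mop n F (of_nat a) (of_nat b) \<noteq> 0"
      then have nz: "pochhammer (of_nat a - of_nat a' + 1 :: complex) c' \<noteq> 0"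
          "pochhammer (of_nat b - of_nat b' + 1 :: complex) e' \<noteq> 0"
        and eq: "of_nat a - of_nat a' + of_nat c' = (of_nat c :: complex)"
          "of_nat b - of_nat b' + of_nat e' = (of_nat e :: complex)"
        by (auto simp: mop_def n' F_def split: if_splits)
      have "(of_nat (a + c') :: complex) = of_nat (c + a')" "(of_nat (b + e') :: complex) = of_nat (e + b')"
        using eq by (simp_all add: algebra_simps)
      then have eq': "a + c' = c + a'" "b + e' = e + b'"
        by (simp_all only: of_nat_eq_iff)
      \<comment> \<open>Otherwise \<open>dx^c'\<close> kills \<open>x^c\<close>: the Pochhammer
        factors run through zero.\<close>
      have "c' \<le> c"
      proof (rule ccontr)
        assume "\<not> c' \<le> c"
        then have "pochhammer (of_int (int a - int a' + 1) :: complex) c' = 0"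
          using eq' by (intro pochhammer_neg_int_eq_0) linarith+
        then show False using nz by simp
      qed
      moreover have "e' \<le> e"
      proof (rule ccontr)
        assume "\<not> e' \<le> e"
        then have "pochhammer (of_int (int b - int b' + 1) :: complex) e' = 0"
          using eq' by (intro pochhammer_neg_int_eq_0) linarith+
        then show False using nz by simp
      qed
      ultimately have "c' = c" "e' = e" using min[OF n(1)] by (auto simp: m' n')
      with eq' n(2) show False by (simp add: m' n')
    qed
  qed
  then have "wop P F (of_nat a) (of_nat b) = P m * mop m F (of_nat a) (of_nat b)"
    unfolding wop_def by (subst sum.remove[OF fin m]) (simp add: sum.neutral)
  also have "\<dots> = P m * fact c * fact e"
    by (simp add: mop_def m' F_def pochhammer_fact)
  finally show False using m 0 by (simp add: wsupp_def)
qed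

text \<open>Faithfulness of the action: identities in the Weyl algebra can be checked on formal
  sums, without expanding \<open>wmult\<close>.\<close>

lemma wop_inject:
  assumes P: "P \<in> weyl_elems" and Q: "Q \<in> weyl_elems"
    and eq: "\<And>F \<alpha> \<beta>. wop P F \<alpha> \<beta> = wop Q F \<alpha> \<beta>"
  shows "P = Q"
proof -
  define R :: weyl where "R = (\<lambda>m. P m - Q m)"
  have fin: "finite (wsupp P \<union> wsupp Q)" using P Q by (auto simp: weyl_elems_def)
  have sub: "wsupp R \<subseteq> wsupp P \<union> wsupp Q" by (auto simp: wsupp_def R_def)
  have "R \<in> weyl_elems" using finite_subset[OF sub fin] by (simp add: weyl_elems_def)
  moreover have "wop R F \<alpha> \<beta> = 0" for F \<alpha> \<beta>
  proof -
    have "wop R F \<alpha> \<beta> = wop P F \<alpha> \<beta> - wop Q F \<alpha> \<beta>"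
      unfolding wop_superset[OF fin sub] wop_superset[OF fin Un_upper1] wop_superset[OF fin Un_upper2]
      by (simp add: R_def sum_subtractf algebra_simps)
    then show ?thesis using eq by simp
  qed
  ultimately have "R = wzero" by (rule wop_eq_0_imp_zero)
  then show ?thesis by (auto simp: R_def wzero_def fun_eq_iff)
qed

section \<open>Shifted expansions of negative powers\<close>

text \<open>Coefficients of the shifted expansion of \<open>(x\<^sup>p + y\<^sup>q)\<^bsup>-(n+1)\<^esup>\<close>: at \<open>\<tau> = \<alpha>/p\<close> the ordinary coefficient
  \<open>(-1)\<^sup>\<tau> binomial (\<tau> + n, n)\<close>, with \<open>(-1)\<^sup>\<tau>\<close> read as \<open>exp (\<i> \<pi> \<tau>)\<close>.\<close>
definition hsol :: "nat \<Rightarrow> nat \<Rightarrow> nat \<Rightarrow> complex \<Rightarrow> formal" where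
  "hsol p q n t \<alpha> \<beta> =
    (if \<alpha> / of_nat p + \<beta> / of_nat q = - of_nat (Suc n) \<and> \<alpha> / of_nat p - t \<in> \<int>
     then exp (\<i> * of_real pi * (\<alpha> / of_nat p)) * ((\<alpha> / of_nat p + of_nat n) gchoose n) else 0)"

lemma exp_ipi_minus_1: "exp (\<i> * of_real pi * (z - 1)) = - exp (\<i> * of_real pi * z)"
  by (simp add: right_diff_distrib exp_diff exp_pi_i)

lemma Ints_diff_1_iff: "z - 1 - t \<in> \<int> \<longleftrightarrow> z - t \<in> \<int>" for z :: complex
proof -
  have "z - 1 - t = (z - t) - 1" by simp
  then show ?thesis by (metis Ints_1 Ints_add Ints_diff diff_add_cancel)
qed

text \<open>Writes the coefficients of \<open>x^p\<close> times the level \<open>n+1\<close> series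
  over the support of level \<open>n\<close>. With its \<open>y\<close> analogue this reduces the
  relations between levels to binomial identities in \<open>\<alpha> / p\<close>.\<close>

lemma hsol_shift_x:
  assumes "0 < p"
  shows "hsol p q (Suc n) t (\<alpha> - of_nat p) \<beta> =
    (if \<alpha> / of_nat p + \<beta> / of_nat q = - of_nat (Suc n) \<and> \<alpha> / of_nat p - t \<in> \<int>
     then - exp (\<i> * of_real pi * (\<alpha> / of_nat p)) * ((\<alpha> / of_nat p + of_nat n) gchoose Suc n) else 0)"
proof -
  have e: "(\<alpha> - of_nat p) / of_nat p = \<alpha> / of_nat p - 1" using assms by (simp add: field_simps)
  have c: "\<alpha> / of_nat p - 1 + \<beta> / of_nat q = - of_nat (Suc (Suc n)) \<longleftrightarrow>
      \<alpha> / of_nat p + \<beta> / of_nat q = - of_nat (Suc n)"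
    by (auto simp: algebra_simps eq_neg_iff_add_eq_0)
  have g: "\<alpha> / of_nat p - 1 + of_nat (Suc n) = \<alpha> / of_nat p + of_nat n" by simp
  show ?thesis unfolding hsol_def e c g Ints_diff_1_iff exp_ipi_minus_1 by simp
qed

lemma hsol_shift_y:
  assumes "0 < q"
  shows "hsol p q (Suc n) t \<alpha> (\<beta> - of_nat q) =
    (if \<alpha> / of_nat p + \<beta> / of_nat q = - of_nat (Suc n) \<and> \<alpha> / of_nat p - t \<in> \<int>
     then exp (\<i> * of_real pi * (\<alpha> / of_nat p)) * ((\<alpha> / of_nat p + of_nat n + 1) gchoose Suc n) else 0)"
proof -
  have e: "(\<beta> - of_nat q) / of_nat q = \<beta> / of_nat q - 1" using assms by (simp add: field_simps)
  have c: "\<alpha> / of_nat p + (\<beta> / of_nat q - 1) = - of_nat (Suc (Suc n)) \<longleftrightarrow>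
      \<alpha> / of_nat p + \<beta> / of_nat q = - of_nat (Suc n)"
    by (auto simp: algebra_simps eq_neg_iff_add_eq_0)
  have g: "\<alpha> / of_nat p + of_nat (Suc n) = \<alpha> / of_nat p + of_nat n + 1" by simp
  show ?thesis unfolding hsol_def e c g ..
qed

text \<open>Formal version of \<open>f * f^(-n-2) = f^(-n-1)\<close>. It is Pascal's rule, the sign
  coming from the exponential factor.\<close>

lemma hsol_mult_f:
  assumes "0 < p" "0 < q"
  shows "hsol p q (Suc n) t (\<alpha> - of_nat p) \<beta> + hsol p q (Suc n) t \<alpha> (\<beta> - of_nat q) = hsol p q n t \<alpha> \<beta>"
proof -
  have "(\<alpha> / of_nat p + of_nat n + 1) gchoose Suc n =
      ((\<alpha> / of_nat p + of_nat n) gchoose n) + ((\<alpha> / of_nat p + of_nat n) gchoose Suc n)"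
    by (rule gbinomial_Suc_Suc)
  then show ?thesis
    unfolding hsol_shift_x[OF assms(1)] hsol_shift_y[OF assms(2)]
    by (simp add: hsol_def distrib_left)
qed

text \<open>Formal version of \<open>x dx f^(-n-1) = -(n+1) p x^p f^(-n-2)\<close>, since
  \<open>x dx\<close> multiplies the coefficient at \<alpha> by \<alpha>. The binomial part is an
  absorption identity.\<close>

lemma hsol_dx:
  assumes "0 < p"
  shows "\<alpha> * hsol p q n t \<alpha> \<beta> = - of_nat (Suc n) * of_nat p * hsol p q (Suc n) t (\<alpha> - of_nat p) \<beta>"
proof -
  define \<tau> where "\<tau> = \<alpha> / of_nat p"
  have \<alpha>: "\<alpha> = of_nat p * \<tau>" using assms by (simp add: \<tau>_def)
  have "\<tau> * ((\<tau> + of_nat n) gchoose n) = of_nat (Suc n) * ((\<tau> + of_nat n) gchoose Suc n)"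
    using gbinomial_mult_1[of "\<tau> + of_nat n" n] by (simp add: algebra_simps)
  then show ?thesis
    unfolding hsol_shift_x[OF assms(1)] unfolding hsol_def \<tau>_def[symmetric]
    by (simp add: \<alpha> del: of_nat_Suc)
qed

lemma hsol_dy:
  assumes "0 < q"
  shows "\<beta> * hsol p q n t \<alpha> \<beta> = - of_nat (Suc n) * of_nat q * hsol p q (Suc n) t \<alpha> (\<beta> - of_nat q)"
proof -
  define \<tau> where "\<tau> = \<alpha> / of_nat p"
  \<comment> \<open>On the support \<beta> is determined by \<tau>, which turns multiplication by
    \<beta> into the factor \<open>\<tau> + n + 1\<close> that the binomial absorbs.\<close>
  have "\<beta> = - of_nat q * (\<tau> + of_nat n + 1)" if "\<tau> + \<beta> / of_nat q = - of_nat (Suc n)"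
  proof -
    have "\<beta> / of_nat q = - (\<tau> + of_nat n + 1)" using that by (simp add: algebra_simps eq_neg_iff_add_eq_0)
    then show ?thesis using assms by (simp add: field_simps)
  qed
  moreover have "(\<tau> + of_nat n + 1) * ((\<tau> + of_nat n) gchoose n) = of_nat (Suc n) * ((\<tau> + of_nat n + 1) gchoose Suc n)"
    using Suc_times_gbinomial[of n "\<tau> + of_nat n"] by simp
  ultimately have "\<beta> * ((\<tau> + of_nat n) gchoose n) =
      - (of_nat (Suc n) * of_nat q * ((\<tau> + of_nat n + 1) gchoose Suc n))"
    if "\<tau> + \<beta> / of_nat q = - of_nat (Suc n)"
    using that by (simp del: of_nat_Suc add: mult.left_commute mult.assoc)
  then show ?thesis
    unfolding hsol_shift_y[OF assms(1)] unfolding hsol_def \<tau>_def[symmetric]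
    by (auto simp del: of_nat_Suc simp: mult.left_commute[of _ "exp (\<i> * of_real pi * \<tau>)"])
qed

section \<open>Rational functions with powers of \<open>f\<close> in the denominator, and their
  formal counterparts\<close>

type_synonym bipoly = "(complex \<times> nat \<times> nat) list"

text \<open>Polynomials are lists of terms with repetitions allowed, so that addition is
  concatenation and differentiation is a \<open>map\<close>.\<close>

definition bpeval :: "bipoly \<Rightarrow> complex \<Rightarrow> complex \<Rightarrow> complex" where
  "bpeval L x y = (\<Sum>(a,i,j)\<leftarrow>L. a * x ^ i * y ^ j)"

definition bpact :: "bipoly \<Rightarrow> formal \<Rightarrow> formal" where
  "bpact L F \<alpha> \<beta> = (\<Sum>(a,i,j)\<leftarrow>L. a * F (\<alpha> - of_nat i) (\<beta> - of_nat j))"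

definition bpshift :: "complex \<Rightarrow> nat \<Rightarrow> nat \<Rightarrow> bipoly \<Rightarrow> bipoly" where
  "bpshift c i0 j0 L = map (\<lambda>(a,i,j). (c * a, i + i0, j + j0)) L"

lemma bpeval_Nil [simp]: "bpeval [] x y = 0"
  and bpeval_Cons: "bpeval ((a,i,j) # L) x y = a * x ^ i * y ^ j + bpeval L x y"
  and bpeval_append [simp]: "bpeval (L @ L') x y = bpeval L x y + bpeval L' x y"
  and bpact_Nil [simp]: "bpact [] F \<alpha> \<beta> = 0"
  and bpact_Cons: "bpact ((a,i,j) # L) F \<alpha> \<beta> = a * F (\<alpha> - of_nat i) (\<beta> - of_nat j) + bpact L F \<alpha> \<beta>"
  and bpact_append [simp]: "bpact (L @ L') F \<alpha> \<beta> = bpact L F \<alpha> \<beta> + bpact L' F \<alpha> \<beta>"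
  by (simp_all add: bpeval_def bpact_def)

lemma bpeval_bpshift [simp]: "bpeval (bpshift c i0 j0 L) x y = c * x ^ i0 * y ^ j0 * bpeval L x y"
  by (induction L) (auto simp: bpshift_def bpeval_def power_add algebra_simps)

lemma bpact_bpshift [simp]:
  "bpact (bpshift c i0 j0 L) F \<alpha> \<beta> = c * bpact L F (\<alpha> - of_nat i0) (\<beta> - of_nat j0)"
  by (induction L) (auto simp: bpshift_def bpact_def algebra_simps)

text \<open>The function \<open>u = L f\<^bsup>-(N+1)\<^esup>\<close> and the formal sum \<open>\<Phi>\<close> obtained by letting the polynomial
  \<open>L\<close> act on the formal solution are tracked simultaneously, so that an operator which kills the
  first kills the second.\<close>
definition rep :: "nat \<Rightarrow> nat \<Rightarrow> complex \<Rightarrow> nat \<Rightarrow> bipoly \<Rightarrow> (complex \<times> complex \<Rightarrow> complex) \<Rightarrow> formal \<Rightarrow> bool" where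
  "rep p q t N L u \<Phi> \<longleftrightarrow>
     (\<forall>x y. x ^ p + y ^ q \<noteq> 0 \<longrightarrow> u (x, y) = bpeval L x y * inverse (x ^ p + y ^ q) ^ Suc N) \<and>
     (\<forall>\<alpha> \<beta>. \<Phi> \<alpha> \<beta> = bpact L (hsol p q N t) \<alpha> \<beta>)"

definition bpmulf :: "nat \<Rightarrow> nat \<Rightarrow> bipoly \<Rightarrow> bipoly" where
  "bpmulf p q L = bpshift 1 p 0 L @ bpshift 1 0 q L"

lemma bpeval_bpmulf: "bpeval (bpmulf p q L) x y = (x ^ p + y ^ q) * bpeval L x y"
  by (simp add: bpmulf_def algebra_simps)

lemma bpact_bpmulf:
  assumes "0 < p" "0 < q"
  shows "bpact (bpmulf p q L) (hsol p q (Suc N) t) \<alpha> \<beta> = bpact L (hsol p q N t) \<alpha> \<beta>"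
proof (induction L)
  case Nil
  show ?case by (simp add: bpmulf_def)
next
  case (Cons m L)
  obtain a i j where m: "m = (a,i,j)" by (cases m) auto
  have "hsol p q N t (\<alpha> - of_nat i) (\<beta> - of_nat j) =
    hsol p q (Suc N) t (\<alpha> - of_nat p - of_nat i) (\<beta> - of_nat j) +
    hsol p q (Suc N) t (\<alpha> - of_nat i) (\<beta> - of_nat q - of_nat j)"
    by (subst hsol_mult_f[OF assms, symmetric]) (simp add: algebra_simps)
  then show ?case using Cons.IH
    by (simp add: m bpmulf_def bpact_Cons algebra_simps)
qed

text \<open>Expanding the fraction by \<open>f\<close> changes its representation but neither
  \<open>u\<close> nor \<Phi>; on the formal side this rests on \<open>hsol_mult_f\<close>.\<close>

lemma rep_Suc:
  assumes "0 < p" "0 < q" "rep p q t N L u \<Phi>"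
  shows "\<exists>L'. rep p q t (Suc N) L' u \<Phi>"
  using assms(3) unfolding rep_def
  by (intro exI[of _ "bpmulf p q L"]) (simp add: bpact_bpmulf[OF assms(1,2)] bpeval_bpmulf)

lemma rep_raise:
  assumes "0 < p" "0 < q" "rep p q t N L u \<Phi>" "N \<le> N'"
  shows "\<exists>L'. rep p q t N' L' u \<Phi>"
  using assms(4)
proof (induction N' rule: dec_induct)
  case base
  then show ?case using assms(3) by blast
next
  case (step k)
  then show ?case using rep_Suc[OF assms(1,2)] by blast
qed

lemma rep_mult_monomial:
  assumes "rep p q t N L u \<Phi>"
  shows "rep p q t N (bpshift c a b L) (\<lambda>z. c * fst z ^ a * snd z ^ b * u z)
     (\<lambda>\<alpha> \<beta>. c * \<Phi> (\<alpha> - of_nat a) (\<beta> - of_nat b))"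
  using assms by (simp add: rep_def)

lemma rep_add:
  assumes "rep p q t N L u \<Phi>" "rep p q t N L' u' \<Phi>'"
  shows "rep p q t N (L @ L') (\<lambda>z. u z + u' z) (\<lambda>\<alpha> \<beta>. \<Phi> \<alpha> \<beta> + \<Phi>' \<alpha> \<beta>)"
  using assms by (simp add: rep_def algebra_simps)

lemma rep_sum:
  assumes "0 < p" "0 < q" "finite S" "\<And>m. m \<in> S \<Longrightarrow> \<exists>N L. rep p q t N L (u m) (\<Phi> m)"
  shows "\<exists>N L. rep p q t N L (\<lambda>z. \<Sum>m\<in>S. u m z) (\<lambda>\<alpha> \<beta>. \<Sum>m\<in>S. \<Phi> m \<alpha> \<beta>)"
  using assms(3,4)
proof (induction S rule: finite_induct)
  case empty
  show ?case by (rule exI[of _ 0], rule exI[of _ "[]"]) (simp add: rep_def)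
next
  case (insert m S)
  then obtain N L where 1: "rep p q t N L (\<lambda>z. \<Sum>m\<in>S. u m z) (\<lambda>\<alpha> \<beta>. \<Sum>m\<in>S. \<Phi> m \<alpha> \<beta>)" by auto
  obtain N' L' where 2: "rep p q t N' L' (u m) (\<Phi> m)" using insert.prems by blast
  obtain L1 where 3: "rep p q t (max N N') L1 (\<lambda>z. \<Sum>m\<in>S. u m z) (\<lambda>\<alpha> \<beta>. \<Sum>m\<in>S. \<Phi> m \<alpha> \<beta>)"
    using rep_raise[OF assms(1,2) 1, of "max N N'"] by auto
  obtain L2 where 4: "rep p q t (max N N') L2 (u m) (\<Phi> m)"
    using rep_raise[OF assms(1,2) 2, of "max N N'"] by auto
  show ?case using rep_add[OF 4 3] insert.hyps by auto
qed

text \<open>For \<open>i = 0\<close> the truncated exponent \<open>i - 1\<close> is harmless because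
  its coefficient is zero.\<close>

lemma has_field_derivative_bpeval_x:
  "((\<lambda>x. bpeval L x y) has_field_derivative
     bpeval (map (\<lambda>(a,i,j). (a * of_nat i, i - 1, j)) L) x y) (at x)"
proof (induction L)
  case (Cons m L)
  obtain a i j where "m = (a,i,j)" by (cases m) auto
  with Cons show ?case
    by (auto simp: bpeval_Cons intro!: derivative_eq_intros)
qed simp

lemma has_field_derivative_bpeval_y:
  "((\<lambda>y. bpeval L x y) has_field_derivative
     bpeval (map (\<lambda>(a,i,j). (a * of_nat j, i, j - 1)) L) x y) (at y)"
proof (induction L)
  case (Cons m L)
  obtain a i j where "m = (a,i,j)" by (cases m) auto
  with Cons show ?case
    by (auto simp: bpeval_Cons intro!: derivative_eq_intros)
qed simp

lemma has_field_derivative_inverse_power: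
  fixes g :: "complex \<Rightarrow> complex"
  assumes "(g has_field_derivative g') (at x)" "g x \<noteq> 0"
  shows "((\<lambda>x. inverse (g x) ^ Suc N) has_field_derivative
     - of_nat (Suc N) * g' * inverse (g x) ^ Suc (Suc N)) (at x)"
  using DERIV_power[OF DERIV_inverse'[OF assms], of "Suc N"]
  by (simp del: of_nat_Suc add: mult.assoc mult.left_commute)

definition fdx :: "formal \<Rightarrow> formal" where "fdx \<Phi> \<alpha> \<beta> = (\<alpha> + 1) * \<Phi> (\<alpha> + 1) \<beta>"
definition fdy :: "formal \<Rightarrow> formal" where "fdy \<Phi> \<alpha> \<beta> = (\<beta> + 1) * \<Phi> \<alpha> (\<beta> + 1)"

text \<open>Quotient rule on both sides at once: the numerator becomes
  \<open>f dL - (N+1) p x^(p-1) L\<close> over one further power of \<open>f\<close>, and on the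
  formal side \<open>hsol_dx\<close> stands for the derivative of the denominator.\<close>

lemma rep_pdx:
  assumes p: "0 < p" and q: "0 < q" and r: "rep p q t N L u \<Phi>"
  shows "\<exists>L'. rep p q t (Suc N) L' (pdx u) (fdx \<Phi>)"
proof -
  define dL where "dL = map (\<lambda>(a,i,j). (a * of_nat i, i - 1, j)) L"
  define c :: complex where "c = - of_nat (Suc N) * of_nat p"
  define L' where "L' = bpmulf p q dL @ bpshift c (p - 1) 0 L"
  have "pdx u (x, y) = bpeval L' x y * inverse (x ^ p + y ^ q) ^ Suc (Suc N)"
    if nz: "x ^ p + y ^ q \<noteq> 0" for x y
  proof -
    have "((\<lambda>x. x ^ p + y ^ q) has_field_derivative of_nat p * x ^ (p - 1)) (at x)"
      by (auto intro!: derivative_eq_intros)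
    then have "((\<lambda>x. bpeval L x y * inverse (x ^ p + y ^ q) ^ Suc N) has_field_derivative
      bpeval dL x y * inverse (x ^ p + y ^ q) ^ Suc N +
      - of_nat (Suc N) * (of_nat p * x ^ (p - 1)) * inverse (x ^ p + y ^ q) ^ Suc (Suc N) * bpeval L x y) (at x)"
      using nz unfolding dL_def
      by (intro DERIV_mult has_field_derivative_bpeval_x has_field_derivative_inverse_power) auto
    moreover have "bpeval dL x y * inverse (x ^ p + y ^ q) ^ Suc N +
      - of_nat (Suc N) * (of_nat p * x ^ (p - 1)) * inverse (x ^ p + y ^ q) ^ Suc (Suc N) * bpeval L x y
      = bpeval L' x y * inverse (x ^ p + y ^ q) ^ Suc (Suc N)"
    proof -
      define w where "w = x ^ p + y ^ q"
      have "bpeval L' x y = w * bpeval dL x y + c * x ^ (p - 1) * bpeval L x y"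
        by (simp add: L'_def bpeval_bpmulf w_def)
      then show ?thesis using nz unfolding w_def[symmetric] c_def by (simp add: distrib_right)
    qed
    ultimately have "((\<lambda>x. bpeval L x y * inverse (x ^ p + y ^ q) ^ Suc N) has_field_derivative
        bpeval L' x y * inverse (x ^ p + y ^ q) ^ Suc (Suc N)) (at x)" by simp
    \<comment> \<open>\<open>u\<close> is known to agree with the fraction only off the zero set of
      \<open>f\<close>; openness lets the derivative pass to \<open>u\<close>.\<close>
    moreover have "open {x. x ^ p + y ^ q \<noteq> 0}"
      by (intro open_Collect_neq continuous_intros)
    ultimately have "((\<lambda>x. u (x, y)) has_field_derivative
        bpeval L' x y * inverse (x ^ p + y ^ q) ^ Suc (Suc N)) (at x)"
      using r nz by (elim has_field_derivative_transform_within_open) (auto simp: rep_def)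
    then show ?thesis by (simp add: pdx_def DERIV_imp_deriv)
  qed
  moreover have "(\<alpha> + 1) * bpact L (hsol p q N t) (\<alpha> + 1) \<beta> =
      bpact dL (hsol p q N t) \<alpha> \<beta> + c * bpact L (hsol p q (Suc N) t) (\<alpha> - of_nat (p - 1)) \<beta>" for \<alpha> \<beta>
    unfolding dL_def
  proof (induction L)
    case (Cons m L)
    obtain a i j where m: "m = (a,i,j)" by (cases m) auto
    have s: "\<alpha> - of_nat (p - 1) - of_nat i = \<alpha> + 1 - of_nat i - of_nat p"
      using p by (simp add: of_nat_diff)
    have i: "of_nat i * hsol p q N t (\<alpha> - of_nat (i - 1)) (\<beta> - of_nat j)
        = of_nat i * hsol p q N t (\<alpha> + 1 - of_nat i) (\<beta> - of_nat j)"
      by (cases i) (simp_all add: algebra_simps)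
    have "(\<alpha> + 1) * hsol p q N t (\<alpha> + 1 - of_nat i) (\<beta> - of_nat j) =
      of_nat i * hsol p q N t (\<alpha> - of_nat (i - 1)) (\<beta> - of_nat j) +
      c * hsol p q (Suc N) t (\<alpha> - of_nat (p - 1) - of_nat i) (\<beta> - of_nat j)"
      using hsol_dx[OF p, of "\<alpha> + 1 - of_nat i" q N t "\<beta> - of_nat j"]
      unfolding i s c_def left_diff_distrib by (simp only: diff_eq_eq add.commute)
    then have "a * ((\<alpha> + 1) * hsol p q N t (\<alpha> + 1 - of_nat i) (\<beta> - of_nat j)) =
      a * (of_nat i * hsol p q N t (\<alpha> - of_nat (i - 1)) (\<beta> - of_nat j) +
      c * hsol p q (Suc N) t (\<alpha> - of_nat (p - 1) - of_nat i) (\<beta> - of_nat j))" by simp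
    then show ?case
      using Cons.IH by (simp add: m bpact_Cons distrib_left mult.left_commute mult.assoc)
  qed simp
  ultimately have "rep p q t (Suc N) L' (pdx u) (fdx \<Phi>)"
    using r by (simp add: rep_def L'_def bpact_bpmulf[OF p q] fdx_def)
  then show ?thesis ..
qed

lemma rep_pdy:
  assumes p: "0 < p" and q: "0 < q" and r: "rep p q t N L u \<Phi>"
  shows "\<exists>L'. rep p q t (Suc N) L' (pdy u) (fdy \<Phi>)"
proof -
  define dL where "dL = map (\<lambda>(a,i,j). (a * of_nat j, i, j - 1)) L"
  define c :: complex where "c = - of_nat (Suc N) * of_nat q"
  define L' where "L' = bpmulf p q dL @ bpshift c 0 (q - 1) L"
  have "pdy u (x, y) = bpeval L' x y * inverse (x ^ p + y ^ q) ^ Suc (Suc N)"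
    if nz: "x ^ p + y ^ q \<noteq> 0" for x y
  proof -
    have "((\<lambda>y. x ^ p + y ^ q) has_field_derivative of_nat q * y ^ (q - 1)) (at y)"
      by (auto intro!: derivative_eq_intros)
    then have "((\<lambda>y. bpeval L x y * inverse (x ^ p + y ^ q) ^ Suc N) has_field_derivative
      bpeval dL x y * inverse (x ^ p + y ^ q) ^ Suc N +
      - of_nat (Suc N) * (of_nat q * y ^ (q - 1)) * inverse (x ^ p + y ^ q) ^ Suc (Suc N) * bpeval L x y) (at y)"
      using nz unfolding dL_def
      by (intro DERIV_mult has_field_derivative_bpeval_y has_field_derivative_inverse_power) auto
    moreover have "bpeval dL x y * inverse (x ^ p + y ^ q) ^ Suc N +
      - of_nat (Suc N) * (of_nat q * y ^ (q - 1)) * inverse (x ^ p + y ^ q) ^ Suc (Suc N) * bpeval L x y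
      = bpeval L' x y * inverse (x ^ p + y ^ q) ^ Suc (Suc N)"
    proof -
      define w where "w = x ^ p + y ^ q"
      have "bpeval L' x y = w * bpeval dL x y + c * y ^ (q - 1) * bpeval L x y"
        by (simp add: L'_def bpeval_bpmulf w_def)
      then show ?thesis using nz unfolding w_def[symmetric] c_def by (simp add: distrib_right)
    qed
    ultimately have "((\<lambda>y. bpeval L x y * inverse (x ^ p + y ^ q) ^ Suc N) has_field_derivative
        bpeval L' x y * inverse (x ^ p + y ^ q) ^ Suc (Suc N)) (at y)" by simp
    moreover have "open {y. x ^ p + y ^ q \<noteq> 0}"
      by (intro open_Collect_neq continuous_intros)
    ultimately have "((\<lambda>y. u (x, y)) has_field_derivative
        bpeval L' x y * inverse (x ^ p + y ^ q) ^ Suc (Suc N)) (at y)"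
      using r nz by (elim has_field_derivative_transform_within_open) (auto simp: rep_def)
    then show ?thesis by (simp add: pdy_def DERIV_imp_deriv)
  qed
  moreover have "(\<beta> + 1) * bpact L (hsol p q N t) \<alpha> (\<beta> + 1) =
      bpact dL (hsol p q N t) \<alpha> \<beta> + c * bpact L (hsol p q (Suc N) t) \<alpha> (\<beta> - of_nat (q - 1))" for \<alpha> \<beta>
    unfolding dL_def
  proof (induction L)
    case (Cons m L)
    obtain a i j where m: "m = (a,i,j)" by (cases m) auto
    have s: "\<beta> - of_nat (q - 1) - of_nat j = \<beta> + 1 - of_nat j - of_nat q"
      using q by (simp add: of_nat_diff)
    have j: "of_nat j * hsol p q N t (\<alpha> - of_nat i) (\<beta> - of_nat (j - 1))
        = of_nat j * hsol p q N t (\<alpha> - of_nat i) (\<beta> + 1 - of_nat j)"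
      by (cases j) (simp_all add: algebra_simps)
    have "(\<beta> + 1) * hsol p q N t (\<alpha> - of_nat i) (\<beta> + 1 - of_nat j) =
      of_nat j * hsol p q N t (\<alpha> - of_nat i) (\<beta> - of_nat (j - 1)) +
      c * hsol p q (Suc N) t (\<alpha> - of_nat i) (\<beta> - of_nat (q - 1) - of_nat j)"
      using hsol_dy[OF q, of "\<beta> + 1 - of_nat j" p N t "\<alpha> - of_nat i"]
      unfolding j s c_def left_diff_distrib by (simp only: diff_eq_eq add.commute)
    then have "a * ((\<beta> + 1) * hsol p q N t (\<alpha> - of_nat i) (\<beta> + 1 - of_nat j)) =
      a * (of_nat j * hsol p q N t (\<alpha> - of_nat i) (\<beta> - of_nat (j - 1)) +
      c * hsol p q (Suc N) t (\<alpha> - of_nat i) (\<beta> - of_nat (q - 1) - of_nat j))" by simp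
    then show ?case
      using Cons.IH by (simp add: m bpact_Cons distrib_left mult.left_commute mult.assoc)
  qed simp
  ultimately have "rep p q t (Suc N) L' (pdy u) (fdy \<Phi>)"
    using r by (simp add: rep_def L'_def bpact_bpmulf[OF p q] fdy_def)
  then show ?thesis ..
qed

lemma rep_pdx_pdy_iterate:
  assumes p: "0 < p" and q: "0 < q" and r: "rep p q t N L u \<Phi>"
  shows "\<exists>N' L'. rep p q t N' L' ((pdx ^^ c) ((pdy ^^ e) u)) ((fdx ^^ c) ((fdy ^^ e) \<Phi>))"
proof -
  have "\<exists>N' L'. rep p q t N' L' ((pdy ^^ e) u) ((fdy ^^ e) \<Phi>)"
    by (induction e) (use r rep_pdy[OF p q] in \<open>auto, blast\<close>)
  then show ?thesis
    by (induction c) (use rep_pdx[OF p q] in \<open>auto, blast\<close>)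
qed

lemma fdx_iterate: "(fdx ^^ c) \<Phi> \<alpha> \<beta> = pochhammer (\<alpha> + 1) c * \<Phi> (\<alpha> + of_nat c) \<beta>"
  by (induction c arbitrary: \<alpha>) (simp_all add: fdx_def pochhammer_rec algebra_simps)

lemma fdy_iterate: "(fdy ^^ c) \<Phi> \<alpha> \<beta> = pochhammer (\<beta> + 1) c * \<Phi> \<alpha> (\<beta> + of_nat c)"
  by (induction c arbitrary: \<beta>) (simp_all add: fdy_def pochhammer_rec algebra_simps)

text \<open>Collects like terms. The function \<open>h\<close> is arbitrary so that evaluation and
  formal action receive the same coefficients.\<close>

lemma bipoly_collect:
  fixes L :: bipoly and M :: nat
  assumes "\<And>a i j. (a,i,j) \<in> set L \<Longrightarrow> i < M \<and> j < M"
  shows "(\<Sum>(a,i,j)\<leftarrow>L. a * h i j) =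
    (\<Sum>i<M. \<Sum>j<M. (\<Sum>(a,i',j')\<leftarrow>L. if i' = i \<and> j' = j then a else 0) * (h i j :: complex))"
  using assms
proof (induction L)
  case (Cons m L)
  obtain a i j where m: "m = (a,i,j)" by (cases m) auto
  then have ij: "i < M" "j < M" using Cons.prems by auto
  have "(\<Sum>j'<M. (if i = i' \<and> j = j' then a else 0) * h i' j') = (if i = i' then a * h i j else 0)" for i'
  proof -
    have "(\<Sum>j'<M. (if i = i' \<and> j = j' then a else 0) * h i' j') =
        (\<Sum>j'<M. if j = j' then (if i = i' then a * h i' j' else 0) else 0)"
      by (intro sum.cong refl) simp
    then show ?thesis using ij by simp
  qed
  then have "(\<Sum>i'<M. \<Sum>j'<M. (if i = i' \<and> j = j' then a else 0) * h i' j') = a * h i j"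
    using ij by simp
  moreover have "(\<Sum>(a,i,j)\<leftarrow>L. a * h i j) =
    (\<Sum>i<M. \<Sum>j<M. (\<Sum>(a,i',j')\<leftarrow>L. if i' = i \<and> j' = j then a else 0) * h i j)"
    using Cons.prems by (intro Cons.IH) auto
  ultimately show ?case by (simp add: m distrib_right sum.distrib)
qed simp

lemma poly_sum_eq_0_coeffs:
  fixes c :: "nat \<Rightarrow> complex"
  assumes "infinite X" "\<And>x. x \<in> X \<Longrightarrow> (\<Sum>i<M. c i * x ^ i) = 0" "i < M"
  shows "c i = 0"
proof -
  define g where "g = (\<Sum>i<M. monom (c i) i)"
  have "X \<subseteq> {x. poly g x = 0}" using assms(2) by (auto simp: g_def poly_sum poly_monom)
  then have "g = 0" using assms(1) finite_subset poly_roots_finite by blast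
  then have "coeff g i = 0" by simp
  then show ?thesis using assms(3) by (simp add: g_def coeff_sum)
qed

text \<open>If the fraction vanishes, the collected coefficients of its numerator are zero, by
  comparing first powers of \<open>y\<close> and then powers of \<open>x\<close>; hence the
  numerator also acts as zero on formal sums.\<close>

lemma rep_eq_0:
  assumes q: "0 < q" and r: "rep p q t N L u \<Phi>"
    and 0: "\<And>x y. x ^ p + y ^ q \<noteq> 0 \<Longrightarrow> u (x, y) = 0"
  shows "\<Phi> \<alpha> \<beta> = 0"
proof -
  define M where "M = Suc (Max (insert 0 ((\<lambda>(a,i,j). i + j) ` set L)))"
  have M: "i < M \<and> j < M" if "(a,i,j) \<in> set L" for a i j
  proof -
    have "i + j \<in> insert 0 ((\<lambda>(a,i,j). i + j) ` set L)" using that by force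
    then have "i + j \<le> Max (insert 0 ((\<lambda>(a,i,j). i + j) ` set L))" by (intro Max_ge) auto
    then show ?thesis by (simp add: M_def)
  qed
  define c where "c = (\<lambda>i j. \<Sum>(a,i',j')\<leftarrow>L. if i' = i \<and> j' = j then a else (0::complex))"
  have ev: "bpeval L x y = (\<Sum>i<M. \<Sum>j<M. c i j * (x ^ i * y ^ j))" for x y
    using bipoly_collect[of L M "\<lambda>i j. x ^ i * y ^ j", OF M] by (simp add: bpeval_def c_def mult.assoc)
  have ac: "bpact L F \<alpha> \<beta> = (\<Sum>i<M. \<Sum>j<M. c i j * F (\<alpha> - of_nat i) (\<beta> - of_nat j))" for F
    using bipoly_collect[of L M "\<lambda>i j. F (\<alpha> - of_nat i) (\<beta> - of_nat j)", OF M]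
    by (simp add: bpact_def c_def)
  have "(\<Sum>i<M. c i j * x ^ i) = 0" if "j < M" for j x
  proof (rule poly_sum_eq_0_coeffs[of "{y. x ^ p + y ^ q \<noteq> 0}" "\<lambda>j. \<Sum>i<M. c i j * x ^ i" M j])
    \<comment> \<open>For fixed \<open>x\<close>, \<open>f\<close> is a polynomial of positive
      degree in \<open>y\<close>, hence nonzero at infinitely many points.\<close>
    define g :: "complex poly" where "g = monom 1 q + [:x ^ p:]"
    have "degree g = q" unfolding g_def using q by (subst degree_add_eq_left) (auto simp: degree_monom_eq)
    then have "g \<noteq> 0" using q by auto
    then have "finite {y. poly g y = 0}" by (rule poly_roots_finite)
    then have "finite {y. x ^ p + y ^ q = 0}" by (simp add: g_def poly_monom add.commute)
    moreover have "infinite (UNIV :: complex set)" by (rule infinite_UNIV_char_0)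
    moreover have "UNIV = {y. x ^ p + y ^ q = 0} \<union> {y. x ^ p + y ^ q \<noteq> 0}" by auto
    ultimately show "infinite {y. x ^ p + y ^ q \<noteq> 0}" by (metis finite_Un)
  next
    fix y assume "y \<in> {y. x ^ p + y ^ q \<noteq> 0}"
    then have "bpeval L x y = 0" using r 0[of x y] by (auto simp: rep_def)
    then have "(\<Sum>j<M. \<Sum>i<M. c i j * (x ^ i * y ^ j)) = 0"
      unfolding ev by (subst sum.swap)
    then show "(\<Sum>j<M. (\<Sum>i<M. c i j * x ^ i) * y ^ j) = 0"
      by (simp add: sum_distrib_right mult.assoc)
  qed fact
  then have "c i j = 0" if "i < M" "j < M" for i j
    using that poly_sum_eq_0_coeffs[of "UNIV :: complex set" "\<lambda>i. c i j" M i] infinite_UNIV_char_0 by blast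
  then have "bpact L (hsol p q N t) \<alpha> \<beta> = 0" unfolding ac by simp
  then show ?thesis using r by (simp add: rep_def)
qed

text \<open>The numerator \<open>1\<close> represents \<open>f^l\<close> and the shifted series
  together. Every term of \<open>P\<close> preserves such pairs, and so does their sum; its function
  side is zero, hence so is its formal side. The shift \<open>t\<close> is arbitrary because the
  relations between levels move \<open>\<alpha> / p\<close> only by integers.\<close>

lemma Ann_fpow_kills_hsol:
  assumes p: "0 < p" and q: "0 < q" and P: "P \<in> Ann_fpow p q (- int (Suc n))"
  shows "wop P (hsol p q n t) \<alpha> \<beta> = 0"
proof -
  let ?f = "fpow p q (- int (Suc n))"
  have el: "finite (wsupp P)" using P by (simp add: Ann_fpow_def Ann_on_def weyl_elems_def)
  have base: "rep p q t n [(1,0,0)] ?f (hsol p q n t)"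
    unfolding rep_def fpow_def
    by (simp add: bpeval_def bpact_def power_int_minus power_inverse del: power_Suc of_nat_Suc)
  define u where "u = (\<lambda>m z. case m of (a,b,c,e) \<Rightarrow> P m * fst z ^ a * snd z ^ b * ((pdx ^^ c) ((pdy ^^ e) ?f)) z)"
  have "\<exists>N L. rep p q t N L (u m) (\<lambda>\<alpha> \<beta>. P m * mop m (hsol p q n t) \<alpha> \<beta>)" for m
  proof -
    obtain a b c e where m: "m = (a,b,c,e)" by (cases m) auto
    obtain N L where "rep p q t N L ((pdx ^^ c) ((pdy ^^ e) ?f)) ((fdx ^^ c) ((fdy ^^ e) (hsol p q n t)))"
      using rep_pdx_pdy_iterate[OF p q base] by blast
    from rep_mult_monomial[OF this, of "P m" a b] show ?thesis
      by (auto simp: m u_def mop_def fdx_iterate fdy_iterate mult.assoc)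
  qed
  then obtain N L where r: "rep p q t N L (\<lambda>z. \<Sum>m\<in>wsupp P. u m z) (\<lambda>\<alpha> \<beta>. \<Sum>m\<in>wsupp P. P m * mop m (hsol p q n t) \<alpha> \<beta>)"
    using rep_sum[OF p q el, of t u "\<lambda>m \<alpha> \<beta>. P m * mop m (hsol p q n t) \<alpha> \<beta>"] by blast
  have "(\<Sum>m\<in>wsupp P. u m (x,y)) = 0" if "x ^ p + y ^ q \<noteq> 0" for x y
    using P that by (auto simp: Ann_fpow_def Ann_on_def fnonzero_def wact_def u_def)
  from rep_eq_0[OF q r this] show ?thesis by (simp add: wop_def)
qed

section \<open>The b-function lies in the initial ideal\<close>

definition wmono :: "complex \<Rightarrow> mono4 \<Rightarrow> weyl" where
  "wmono c m = (\<lambda>m'. if m' = m then c else 0)"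

lemma wmono_elems: "wmono c m \<in> weyl_elems"
proof -
  have "wsupp (wmono c m) \<subseteq> {m}" by (auto simp: wsupp_def wmono_def)
  then show ?thesis by (auto simp: weyl_elems_def intro: finite_subset)
qed

lemma wop_wmono: "wop (wmono c m) F \<alpha> \<beta> = c * mop m F \<alpha> \<beta>"
  by (subst wop_superset[of "{m}"]) (auto simp: wsupp_def wmono_def)

lemma wop_sum:
  assumes "finite S" "\<And>i. i \<in> S \<Longrightarrow> Q i \<in> weyl_elems"
  shows "(\<lambda>m. \<Sum>i\<in>S. c i * Q i m) \<in> weyl_elems"
    and "wop (\<lambda>m. \<Sum>i\<in>S. c i * Q i m) F \<alpha> \<beta> = (\<Sum>i\<in>S. c i * wop (Q i) F \<alpha> \<beta>)"
proof -
  let ?U = "\<Union>i\<in>S. wsupp (Q i)"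
  have fin: "finite ?U" using assms by (auto simp: weyl_elems_def)
  have sub: "wsupp (\<lambda>m. \<Sum>i\<in>S. c i * Q i m) \<subseteq> ?U"
  proof
    fix m assume "m \<in> wsupp (\<lambda>m. \<Sum>i\<in>S. c i * Q i m)"
    then have "(\<Sum>i\<in>S. c i * Q i m) \<noteq> 0" by (simp add: wsupp_def)
    then obtain i where "i \<in> S" "c i * Q i m \<noteq> 0"
      by (meson sum.not_neutral_contains_not_neutral)
    then show "m \<in> ?U" by (auto simp: wsupp_def)
  qed
  show "(\<lambda>m. \<Sum>i\<in>S. c i * Q i m) \<in> weyl_elems"
    using finite_subset[OF sub fin] by (simp add: weyl_elems_def)
  have "wop (Q i) F \<alpha> \<beta> = (\<Sum>m\<in>?U. Q i m * mop m F \<alpha> \<beta>)" if "i \<in> S" for i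
    using that by (intro wop_superset[OF fin]) auto
  then have "(\<Sum>i\<in>S. c i * wop (Q i) F \<alpha> \<beta>) = (\<Sum>i\<in>S. \<Sum>m\<in>?U. c i * (Q i m * mop m F \<alpha> \<beta>))"
    by (simp add: sum_distrib_left)
  also have "\<dots> = (\<Sum>m\<in>?U. \<Sum>i\<in>S. c i * (Q i m * mop m F \<alpha> \<beta>))" by (rule sum.swap)
  also have "\<dots> = wop (\<lambda>m. \<Sum>i\<in>S. c i * Q i m) F \<alpha> \<beta>"
    unfolding wop_superset[OF fin sub] by (simp add: sum_distrib_right mult.assoc)
  finally show "wop (\<lambda>m. \<Sum>i\<in>S. c i * Q i m) F \<alpha> \<beta> = (\<Sum>i\<in>S. c i * wop (Q i) F \<alpha> \<beta>)" ..
qed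

lemma s_op_elems: "s_op \<omega> \<in> weyl_elems"
proof -
  have "wsupp (s_op \<omega>) \<subseteq> {(1,0,1,0), (0,1,0,1)}" by (auto simp: wsupp_def s_op_def split: if_splits)
  then show ?thesis by (auto simp: weyl_elems_def intro: finite_subset)
qed

lemma wop_s_op: "wop (s_op \<omega>) F \<alpha> \<beta> = (of_real (fst \<omega>) * \<alpha> + of_real (snd \<omega>) * \<beta>) * F \<alpha> \<beta>"
  by (subst wop_superset[of "{(1,0,1,0), (0,1,0,1)}"])
    (auto simp: wsupp_def s_op_def mop_def distrib_right split: if_splits)

lemma wpow_s_op: "wpow (s_op \<omega>) i \<in> weyl_elems"
  and wop_wpow_s_op: "wop (wpow (s_op \<omega>) i) F \<alpha> \<beta> = (of_real (fst \<omega>) * \<alpha> + of_real (snd \<omega>) * \<beta>) ^ i * F \<alpha> \<beta>"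
proof (induction i)
  case 0
  have w: "wone = wmono 1 (0,0,0,0)" by (simp add: wone_def wmono_def)
  { case 1 show ?case by (simp add: w wmono_elems)
  next case 2 show ?case by (simp add: w wop_wmono mop_def) }
next
  case (Suc i)
  { case 1 show ?case using Suc.IH(1) by (simp add: wmult_elems s_op_elems)
  next case 2 show ?case using Suc.IH by (simp add: wop_wmult s_op_elems wop_s_op) }
qed

lemma weyl_of_poly_elems: "weyl_of_poly \<omega> g \<in> weyl_elems"
  unfolding weyl_of_poly_def by (intro wop_sum wpow_s_op) auto

lemma wop_weyl_of_poly:
  "wop (weyl_of_poly \<omega> g) F \<alpha> \<beta> = poly g (of_real (fst \<omega>) * \<alpha> + of_real (snd \<omega>) * \<beta>) * F \<alpha> \<beta>"
  unfolding weyl_of_poly_def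
  by (subst wop_sum) (auto simp: wpow_s_op wop_wpow_s_op poly_altdef sum_distrib_right mult.assoc)

text \<open>Both sides act diagonally with the same eigenvalues.\<close>

lemma weyl_of_poly_mult:
  "weyl_of_poly \<omega> (g * h) = wmult (weyl_of_poly \<omega> g) (weyl_of_poly \<omega> h)"
  by (rule wop_inject)
    (simp_all add: weyl_of_poly_elems wmult_elems wop_wmult wop_weyl_of_poly)

text \<open>Polynomials in \<open>x \<partial>\<^sub>x\<close> and \<open>y \<partial>\<^sub>y\<close>, identified with their eigenvalues on \<open>x\<^sup>\<alpha> y\<^sup>\<beta>\<close>.\<close>
definition toric :: "(complex \<Rightarrow> complex \<Rightarrow> complex) \<Rightarrow> bool" where
  "toric h \<longleftrightarrow> (\<exists>A\<in>weyl_elems. \<forall>F \<alpha> \<beta>. wop A F \<alpha> \<beta> = h \<alpha> \<beta> * F \<alpha> \<beta>)"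

lemma toric_const: "toric (\<lambda>\<alpha> \<beta>. c)"
  unfolding toric_def by (rule bexI[of _ "wmono c (0,0,0,0)"]) (auto simp: wop_wmono mop_def wmono_elems)

lemma toric_x: "toric (\<lambda>\<alpha> \<beta>. \<alpha>)"
  unfolding toric_def by (rule bexI[of _ "wmono 1 (1,0,1,0)"]) (auto simp: wop_wmono mop_def wmono_elems)

lemma toric_y: "toric (\<lambda>\<alpha> \<beta>. \<beta>)"
  unfolding toric_def by (rule bexI[of _ "wmono 1 (0,1,0,1)"]) (auto simp: wop_wmono mop_def wmono_elems)

lemma toric_add:
  assumes "toric g" "toric h"
  shows "toric (\<lambda>\<alpha> \<beta>. g \<alpha> \<beta> + h \<alpha> \<beta>)"
proof -
  obtain A B where "A \<in> weyl_elems" "\<And>F \<alpha> \<beta>. wop A F \<alpha> \<beta> = g \<alpha> \<beta> * F \<alpha> \<beta>"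
    "B \<in> weyl_elems" "\<And>F \<alpha> \<beta>. wop B F \<alpha> \<beta> = h \<alpha> \<beta> * F \<alpha> \<beta>"
    using assms unfolding toric_def by blast
  then show ?thesis unfolding toric_def
    by (intro bexI[of _ "wadd A B"]) (auto simp: wop_wadd wadd_elems distrib_right)
qed

lemma toric_mult:
  assumes "toric g" "toric h"
  shows "toric (\<lambda>\<alpha> \<beta>. g \<alpha> \<beta> * h \<alpha> \<beta>)"
proof -
  obtain A B where "A \<in> weyl_elems" "\<And>F \<alpha> \<beta>. wop A F \<alpha> \<beta> = g \<alpha> \<beta> * F \<alpha> \<beta>"
    "B \<in> weyl_elems" "\<And>F \<alpha> \<beta>. wop B F \<alpha> \<beta> = h \<alpha> \<beta> * F \<alpha> \<beta>"
    using assms unfolding toric_def by blast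
  then show ?thesis unfolding toric_def
    by (intro bexI[of _ "wmult A B"]) (auto simp: wop_wmult wmult_elems)
qed

lemma toric_prod:
  "finite J \<Longrightarrow> (\<And>i. i \<in> J \<Longrightarrow> toric (h i)) \<Longrightarrow> toric (\<lambda>\<alpha> \<beta>. \<Prod>i\<in>J. h i \<alpha> \<beta>)"
  by (induction J rule: finite_induct) (auto simp: toric_const intro: toric_mult)

section \<open>The Euler and tangent operators and their initial forms\<close>

definition euler_op :: "nat \<Rightarrow> nat \<Rightarrow> nat \<Rightarrow> weyl" where
  "euler_op p q n = (\<lambda>m. if m = (1,0,1,0) then of_nat q else if m = (0,1,0,1) then of_nat p
     else if m = (0,0,0,0) then of_nat (p * q * Suc n) else 0)"

text \<open>The Hamiltonian vector field of \<open>f\<close>, which kills every power of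
  \<open>f\<close>.\<close>

definition tangent_op :: "nat \<Rightarrow> nat \<Rightarrow> weyl" where
  "tangent_op p q = (\<lambda>m. if m = (0,q-1,1,0) then of_nat q
     else if m = (p-1,0,0,1) then - of_nat p else 0)"

lemma wsupp_euler_op: "wsupp (euler_op p q n) \<subseteq> {(1,0,1,0), (0,1,0,1), (0,0,0,0)}"
  by (auto simp: wsupp_def euler_op_def split: if_splits)

lemma wsupp_tangent_op: "0 < p \<Longrightarrow> 0 < q \<Longrightarrow> wsupp (tangent_op p q) = {(0,q-1,1,0), (p-1,0,0,1)}"
  by (auto simp: wsupp_def tangent_op_def split: if_splits)

lemma euler_op_elems: "euler_op p q n \<in> weyl_elems"
  using finite_subset[OF wsupp_euler_op] by (simp add: weyl_elems_def)

lemma wop_euler_op: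
  "wop (euler_op p q n) F \<alpha> \<beta> = (of_nat q * \<alpha> + of_nat p * \<beta> + of_nat (p * q * Suc n)) * F \<alpha> \<beta>"
  by (subst wop_superset[OF _ wsupp_euler_op]) (auto simp: euler_op_def mop_def distrib_right)

text \<open>All monomials of the Euler operator have weight zero, whatever \<omega> is.\<close>

lemma winit_euler_op: "winit \<omega> (euler_op p q n) = euler_op p q n"
proof (rule ext)
  fix m
  have 0: "wt \<omega> m = 0" if "m \<in> wsupp (euler_op p q n)" for m
    using that wsupp_euler_op[of p q n] by (auto simp: wt_def)
  have "wt \<omega> ` wsupp (euler_op p q n) = {0}" if "m \<in> wsupp (euler_op p q n)"
  proof -
    have "wt \<omega> ` wsupp (euler_op p q n) = (\<lambda>_. 0) ` wsupp (euler_op p q n)"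
      by (intro image_cong refl 0)
    with that show ?thesis by (auto simp: image_constant_conv)
  qed
  then show "winit \<omega> (euler_op p q n) m = euler_op p q n m"
    using 0[of m] by (cases "m \<in> wsupp (euler_op p q n)") (simp_all add: winit_def, simp add: wsupp_def)
qed

text \<open>The weights of the two terms differ by
  \<open>p * \<omega>1 - q * \<omega>2\<close>.\<close>

lemma winit_tangent_op:
  assumes "0 < p" "0 < q" "real p * \<omega>1 > real q * \<omega>2"
  shows "winit (\<omega>1, \<omega>2) (tangent_op p q) = wmono (of_nat q) (0,q-1,1,0)"
proof (rule ext)
  fix m
  let ?\<omega> = "(\<omega>1, \<omega>2)"
  have lt: "wt ?\<omega> (p-1,0,0,1) < wt ?\<omega> (0,q-1,1,0)"
    using assms by (simp add: wt_def of_nat_diff algebra_simps)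
  then have M: "Max (wt ?\<omega> ` wsupp (tangent_op p q)) = wt ?\<omega> (0,q-1,1,0)"
    by (simp add: wsupp_tangent_op[OF assms(1,2)])
  consider "m = (0,q-1,1,0)" | "m = (p-1,0,0,1)" | "m \<notin> wsupp (tangent_op p q)"
    unfolding wsupp_tangent_op[OF assms(1,2)] by blast
  then show "winit ?\<omega> (tangent_op p q) m = wmono (of_nat q) (0,q-1,1,0) m"
  proof cases
    case 1
    then show ?thesis
      unfolding winit_def M by (simp add: wsupp_def wmono_def tangent_op_def)
  next
    case 2
    then have "wt ?\<omega> m \<noteq> wt ?\<omega> (0,q-1,1,0)" using lt by simp
    then show ?thesis unfolding winit_def M using 2 by (simp add: wmono_def)
  next
    case 3
    then have "m \<noteq> (0,q-1,1,0)" by (simp add: wsupp_tangent_op[OF assms(1,2)])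
    with 3 show ?thesis by (simp add: winit_def wmono_def)
  qed
qed

text \<open>The index \<open>i = (n+1) q\<close> gives the remaining root \<open>l q \<omega>\<^sub>2\<close> of the b-function.\<close>
definition broot :: "nat \<Rightarrow> nat \<Rightarrow> nat \<Rightarrow> real \<times> real \<Rightarrow> nat \<Rightarrow> real" where
  "broot p q n \<omega> i = real p * (real i / real q - real (Suc n)) * fst \<omega> - real i * snd \<omega>"

text \<open>The root is the value of \<open>s\<close> at the point with \<open>\<beta> = -i\<close>
  on the line where the Euler eigenvalue vanishes, so the difference is a combination of the two
  linear forms vanishing there.\<close>

lemma s_minus_broot:
  fixes \<alpha> \<beta> :: complex
  assumes "0 < q"
  shows "of_real (fst \<omega>) * \<alpha> + of_real (snd \<omega>) * \<beta> - of_real (broot p q n \<omega> i) =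
    of_real (snd \<omega> - real p * fst \<omega> / real q) * (\<beta> + of_nat i) +
    of_real (fst \<omega> / real q) * (of_nat q * \<alpha> + of_nat p * \<beta> + of_nat (p * q * Suc n))"
proof -
  define w1 w2 P Q i' N where "w1 = (of_real (fst \<omega>) :: complex)" and "w2 = (of_real (snd \<omega>) :: complex)"
    and "P = (of_nat p :: complex)" and "Q = (of_nat q :: complex)"
    and "i' = (of_nat i :: complex)" and "N = (of_nat (Suc n) :: complex)"
  note defs = this
  have "Q \<noteq> 0" using assms by (simp add: defs)
  then have "w1 * \<alpha> + w2 * \<beta> - (P * (i' / Q - N) * w1 - i' * w2) =
      (w2 - P * w1 / Q) * (\<beta> + i') + w1 / Q * (Q * \<alpha> + P * \<beta> + P * Q * N)"
    by (simp add: divide_simps) algebra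
  then show ?thesis unfolding defs broot_def by (simp del: of_nat_Suc mult_Suc_right)
qed

text \<open>Multiply the relations of \<open>s_minus_broot\<close>: every mixed term contains the
  Euler factor. The cofactor is required to be \<open>toric\<close> so that it comes from an
  operator.\<close>

lemma prod_s_minus_broot:
  assumes "0 < q" "finite J"
  shows "\<exists>A. toric A \<and> (\<forall>\<alpha> \<beta>.
    (\<Prod>i\<in>J. of_real (fst \<omega>) * \<alpha> + of_real (snd \<omega>) * \<beta> - of_real (broot p q n \<omega> i)) =
    (\<Prod>i\<in>J. of_real (snd \<omega> - real p * fst \<omega> / real q) * (\<beta> + of_nat i)) +
    A \<alpha> \<beta> * (of_nat q * \<alpha> + of_nat p * \<beta> + of_nat (p * q * Suc n)))"
  using assms(2)
proof (induction J rule: finite_induct)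
  case empty
  show ?case by (rule exI[of _ "\<lambda>_ _. 0"]) (simp add: toric_const)
next
  case (insert j J)
  define e where "e = (\<lambda>\<alpha> \<beta>. of_nat q * \<alpha> + of_nat p * \<beta> + (of_nat (p * q * Suc n) :: complex))"
  define k :: complex where "k = of_real (snd \<omega> - real p * fst \<omega> / real q)"
  define c :: complex where "c = of_real (fst \<omega> / real q)"
  define s where "s = (\<lambda>i \<alpha> \<beta>. of_real (fst \<omega>) * \<alpha> + of_real (snd \<omega>) * \<beta> - (of_real (broot p q n \<omega> i) :: complex))"
  have s: "s i \<alpha> \<beta> = k * (\<beta> + of_nat i) + c * e \<alpha> \<beta>" for i \<alpha> \<beta>
    unfolding s_def k_def c_def e_def by (rule s_minus_broot[OF assms(1)])
  obtain A where A: "toric A" "\<And>\<alpha> \<beta>. (\<Prod>i\<in>J. s i \<alpha> \<beta>) = (\<Prod>i\<in>J. k * (\<beta> + of_nat i)) + A \<alpha> \<beta> * e \<alpha> \<beta>"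
    using insert.IH unfolding s_def k_def e_def by blast
  define A' where "A' = (\<lambda>\<alpha> \<beta>. k * (\<beta> + of_nat j) * A \<alpha> \<beta> + c * (\<Prod>i\<in>J. s i \<alpha> \<beta>))"
  have "toric (s i)" for i
    unfolding s_def diff_conv_add_uminus by (intro toric_add toric_mult toric_const toric_x toric_y)
  then have "toric A'"
    unfolding A'_def using A(1) insert.hyps
    by (intro toric_add toric_mult toric_const toric_y toric_prod) auto
  moreover have "(\<Prod>i\<in>insert j J. s i \<alpha> \<beta>) = (\<Prod>i\<in>insert j J. k * (\<beta> + of_nat i)) + A' \<alpha> \<beta> * e \<alpha> \<beta>" for \<alpha> \<beta>
  proof -
    have "(\<Prod>i\<in>insert j J. s i \<alpha> \<beta>) = k * (\<beta> + of_nat j) * (\<Prod>i\<in>J. s i \<alpha> \<beta>) + c * e \<alpha> \<beta> * (\<Prod>i\<in>J. s i \<alpha> \<beta>)"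
      using insert.hyps by (simp add: s[of j] distrib_right)
    also have "k * (\<beta> + of_nat j) * (\<Prod>i\<in>J. s i \<alpha> \<beta>) =
        (\<Prod>i\<in>insert j J. k * (\<beta> + of_nat i)) + k * (\<beta> + of_nat j) * (A \<alpha> \<beta> * e \<alpha> \<beta>)"
      using insert.hyps unfolding A(2) by (simp add: distrib_left)
    finally show ?thesis unfolding A'_def by (simp only: ring_distribs mult_ac add_ac)
  qed
  ultimately show ?case unfolding s_def k_def e_def by blast
qed

definition bidx :: "nat \<Rightarrow> nat \<Rightarrow> nat set" where
  "bidx q n = insert (Suc n * q) {1..q-1}"

definition bpoly :: "nat \<Rightarrow> nat \<Rightarrow> nat \<Rightarrow> real \<times> real \<Rightarrow> nat set \<Rightarrow> complex poly" where
  "bpoly p q n \<omega> J = (\<Prod>i\<in>J. [:- of_real (broot p q n \<omega> i), 1:])"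

lemma poly_bpoly: "poly (bpoly p q n \<omega> J) s = (\<Prod>i\<in>J. s - of_real (broot p q n \<omega> i))"
  by (simp add: bpoly_def poly_prod)

lemma init_ideal_winit: "P \<in> I \<Longrightarrow> winit \<omega> P \<in> init_ideal \<omega> I"
  unfolding init_ideal_def by (intro left_ideal_gen.gen imageI)

lemma prod_shift_eq_pochhammer: "(\<Prod>i\<in>{1..m}. \<beta> + of_nat i) = pochhammer (\<beta> + 1 :: complex) m"
  by (induction m) (simp_all add: pochhammer_Suc algebra_simps)

text \<open>An explicit combination \<open>C E + B T0\<close> of the two initial forms equals the
  polynomial in \<open>s\<close>; the equality is checked on eigenvalues.\<close>

lemma bpoly_in_init_ideal:
  assumes p: "0 < p" and q: "0 < q" and gt: "real p * \<omega>1 > real q * \<omega>2"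
    and E: "euler_op p q n \<in> I" and T: "tangent_op p q \<in> I"
  shows "weyl_of_poly (\<omega>1,\<omega>2) (bpoly p q n (\<omega>1,\<omega>2) (bidx q n)) \<in> init_ideal (\<omega>1,\<omega>2) I"
proof -
  let ?\<omega> = "(\<omega>1,\<omega>2)"
  define k :: complex where "k = of_real (\<omega>2 - real p * \<omega>1 / real q)"
  define e where "e = (\<lambda>\<alpha> \<beta>. of_nat q * \<alpha> + of_nat p * \<beta> + (of_nat (p * q * Suc n) :: complex))"
  have fin: "finite (bidx q n)" by (simp add: bidx_def)
  obtain A where A: "toric A" and Aeq: "\<And>\<alpha> \<beta>. (\<Prod>i\<in>bidx q n. of_real \<omega>1 * \<alpha> + of_real \<omega>2 * \<beta> - of_real (broot p q n ?\<omega> i)) =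
    (\<Prod>i\<in>bidx q n. k * (\<beta> + of_nat i)) + A \<alpha> \<beta> * e \<alpha> \<beta>"
    using prod_s_minus_broot[OF q fin, of ?\<omega> p n] unfolding k_def e_def by auto
  \<comment> \<open>From \<open>k (\<beta> + (n+1) q) = (k/p) (e - q \<alpha>)\<close>: modulo the
    Euler operator the extra factor becomes a multiple of \<open>x dx\<close>, and the other factors
    contribute \<open>k^(q-1)\<close>.\<close>
  define d where "d = k ^ q / of_nat p"
  have prodk: "(\<Prod>i\<in>bidx q n. k * (\<beta> + of_nat i)) =
      d * (\<Prod>i\<in>{1..q-1}. \<beta> + of_nat i) * e \<alpha> \<beta> - d * pochhammer (\<beta> + 1) (q - 1) * (of_nat q * \<alpha>)" for \<alpha> \<beta>
  proof -
    have notin: "Suc n * q \<notin> {1..q-1}" using q by auto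
    have kq: "k * k ^ (q - 1) = k ^ q" using q by (cases q) simp_all
    have "(\<Prod>i\<in>bidx q n. k * (\<beta> + of_nat i)) =
       k * (\<beta> + of_nat (Suc n * q)) * (k ^ (q - 1) * (\<Prod>i\<in>{1..q-1}. \<beta> + of_nat i))"
      unfolding bidx_def using notin by (simp add: prod.distrib)
    also have "\<dots> = k ^ q * (\<beta> + of_nat (Suc n * q)) * (\<Prod>i\<in>{1..q-1}. \<beta> + of_nat i)"
      by (simp add: kq[symmetric] mult_ac)
    also have "k ^ q * (\<beta> + of_nat (Suc n * q)) = d * (e \<alpha> \<beta> - of_nat q * \<alpha>)"
      using p by (simp add: d_def e_def field_simps)
    also have "d * (e \<alpha> \<beta> - of_nat q * \<alpha>) * (\<Prod>i\<in>{1..q-1}. \<beta> + of_nat i) =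
        d * (\<Prod>i\<in>{1..q-1}. \<beta> + of_nat i) * e \<alpha> \<beta> - d * pochhammer (\<beta> + 1) (q - 1) * (of_nat q * \<alpha>)"
      unfolding prod_shift_eq_pochhammer by (simp only: right_diff_distrib left_diff_distrib mult_ac)
    finally show ?thesis .
  qed
  have "toric (\<lambda>\<alpha> \<beta>. A \<alpha> \<beta> + d * (\<Prod>i\<in>{1..q-1}. \<beta> + of_nat i))"
    by (intro toric_add A toric_mult toric_const toric_prod toric_y) auto
  then obtain C where C: "C \<in> weyl_elems"
    and opC: "\<And>F \<alpha> \<beta>. wop C F \<alpha> \<beta> = (A \<alpha> \<beta> + d * (\<Prod>i\<in>{1..q-1}. \<beta> + of_nat i)) * F \<alpha> \<beta>"
    unfolding toric_def by blast
  \<comment> \<open>Chosen so that \<open>B T0\<close> acts by the part of \<open>prodk\<close>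
    without the Euler factor.\<close>
  define B where "B = wmono (- d) (1,0,0,q-1)"
  define T0 where "T0 = wmono (of_nat q) (0,q-1,1,0)"
  have "weyl_of_poly ?\<omega> (bpoly p q n ?\<omega> (bidx q n)) = wadd (wmult C (euler_op p q n)) (wmult B T0)"
  proof (rule wop_inject)
    fix F \<alpha> \<beta>
    have "wop (wmult B T0) F \<alpha> \<beta> = - d * pochhammer (\<beta> + 1) (q - 1) * (of_nat q * \<alpha>) * F \<alpha> \<beta>"
      by (simp add: B_def T0_def wop_wmult wmono_elems wop_wmono mop_def)
    moreover have "wop (wmult C (euler_op p q n)) F \<alpha> \<beta> = (A \<alpha> \<beta> + d * (\<Prod>i\<in>{1..q-1}. \<beta> + of_nat i)) * (e \<alpha> \<beta> * F \<alpha> \<beta>)"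
      by (simp add: wop_wmult C euler_op_elems opC wop_euler_op e_def)
    moreover have "wop (weyl_of_poly ?\<omega> (bpoly p q n ?\<omega> (bidx q n))) F \<alpha> \<beta> =
      ((\<Prod>i\<in>bidx q n. k * (\<beta> + of_nat i)) + A \<alpha> \<beta> * e \<alpha> \<beta>) * F \<alpha> \<beta>"
      by (simp add: wop_weyl_of_poly poly_bpoly Aeq)
    moreover have "wop (wadd (wmult C (euler_op p q n)) (wmult B T0)) F \<alpha> \<beta> =
        wop (wmult C (euler_op p q n)) F \<alpha> \<beta> + wop (wmult B T0) F \<alpha> \<beta>"
      by (simp add: wop_wadd C euler_op_elems B_def T0_def wmono_elems wmult_elems)
    ultimately show "wop (weyl_of_poly ?\<omega> (bpoly p q n ?\<omega> (bidx q n))) F \<alpha> \<beta> =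
       wop (wadd (wmult C (euler_op p q n)) (wmult B T0)) F \<alpha> \<beta>"
      unfolding prodk[of _ \<alpha>] by (simp add: distrib_right left_diff_distrib)
  qed (simp_all add: weyl_of_poly_elems C euler_op_elems B_def T0_def wmono_elems wmult_elems wadd_elems)
  moreover have "wmult C (euler_op p q n) \<in> init_ideal ?\<omega> I"
    using init_ideal_winit[OF E, of ?\<omega>] C unfolding winit_euler_op init_ideal_def
    by (intro left_ideal_gen.lmult)
  moreover have "wmult B T0 \<in> init_ideal ?\<omega> I"
    using init_ideal_winit[OF T, of ?\<omega>] unfolding winit_tangent_op[OF p q gt] init_ideal_def T0_def B_def
    by (intro left_ideal_gen.lmult wmono_elems)
  ultimately show ?thesis unfolding init_ideal_def by (simp add: left_ideal_gen.add)
qed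

text \<open>On the wall the coefficient of \<open>\<beta> + i\<close> in
  \<open>s_minus_broot\<close> is zero, so the linear polynomial is a scalar multiple of the Euler
  operator for every \<open>i\<close>.\<close>

lemma linear_bpoly_in_init_ideal:
  assumes p: "0 < p" and q: "0 < q" and eq: "real p * \<omega>1 = real q * \<omega>2"
    and E: "euler_op p q n \<in> I"
  shows "weyl_of_poly (\<omega>1,\<omega>2) (bpoly p q n (\<omega>1,\<omega>2) {i}) \<in> init_ideal (\<omega>1,\<omega>2) I"
proof -
  let ?\<omega> = "(\<omega>1,\<omega>2)"
  define C where "C = wmono (of_real (\<omega>1 / real q)) (0,0,0,0)"
  have k: "\<omega>2 - real p * \<omega>1 / real q = 0" using eq q by simp
  have "weyl_of_poly ?\<omega> (bpoly p q n ?\<omega> {i}) = wmult C (euler_op p q n)"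
  proof (rule wop_inject)
    fix F \<alpha> \<beta>
    show "wop (weyl_of_poly ?\<omega> (bpoly p q n ?\<omega> {i})) F \<alpha> \<beta> = wop (wmult C (euler_op p q n)) F \<alpha> \<beta>"
      using s_minus_broot[OF q, of ?\<omega> \<alpha> \<beta> p n i] unfolding fst_conv snd_conv k
      by (simp add: wop_weyl_of_poly poly_bpoly C_def wop_wmult wmono_elems euler_op_elems wop_wmono
          mop_def wop_euler_op)
  qed (simp_all add: weyl_of_poly_elems C_def wmono_elems wmult_elems euler_op_elems)
  moreover have "wmult C (euler_op p q n) \<in> init_ideal ?\<omega> I"
    using init_ideal_winit[OF E, of ?\<omega>] unfolding winit_euler_op init_ideal_def C_def
    by (intro left_ideal_gen.lmult wmono_elems)
  ultimately show ?thesis by simp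
qed

section \<open>Roots forced by the initial ideal\<close>

text \<open>Sums without negative integer \<open>y\<close>-exponents form a submodule:
  \<open>dy\<close> kills \<open>y^0\<close>, so differentiation never leads from nonnegative to
  negative integer exponents.\<close>

lemma mop_vanish_negative_y:
  assumes K: "\<And>\<alpha> b. b < 0 \<Longrightarrow> K \<alpha> (of_int b) = 0" and b: "b < 0"
  shows "mop m K \<alpha> (of_int b) = 0"
proof -
  obtain a b' c e where m: "m = (a,b',c,e)" by (cases m) auto
  have s: "of_int b - of_nat b' + of_nat e = (of_int (b - int b' + int e) :: complex)"
    and p: "of_int b - of_nat b' + 1 = (of_int (b - int b' + 1) :: complex)" by simp_all
  show ?thesis
  proof (cases "b - int b' + int e < 0")
    case True
    then show ?thesis unfolding m mop_def prod.case s K[OF True] by simp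
  next
    case False
    then have "pochhammer (of_int (b - int b' + 1) :: complex) e = 0"
      using b by (intro pochhammer_neg_int_eq_0) auto
    then show ?thesis unfolding m mop_def prod.case p by simp
  qed
qed

text \<open>The sign is opposite to that of \<open>wt\<close>: an operator of weight
  \<open>d\<close> lowers \<open>expwt\<close> by \<open>d\<close>, so maximal parts of operators
  meet minimal parts of formal sums.\<close>

definition expwt :: "real \<times> real \<Rightarrow> complex \<Rightarrow> complex \<Rightarrow> real" where
  "expwt \<omega> \<alpha> \<beta> = fst \<omega> * Re \<alpha> + snd \<omega> * Re \<beta>"

lemma mop_cong_weight:
  assumes "\<And>\<alpha>' \<beta>'. expwt \<omega> \<alpha>' \<beta>' = expwt \<omega> \<alpha> \<beta> + wt \<omega> m \<Longrightarrow> F \<alpha>' \<beta>' = G \<alpha>' \<beta>'"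
  shows "mop m F \<alpha> \<beta> = mop m G \<alpha> \<beta>"
proof -
  obtain a b c e where m: "m = (a,b,c,e)" by (cases m) auto
  have "F (\<alpha> - of_nat a + of_nat c) (\<beta> - of_nat b + of_nat e) =
      G (\<alpha> - of_nat a + of_nat c) (\<beta> - of_nat b + of_nat e)"
    by (rule assms) (simp add: expwt_def wt_def m algebra_simps)
  then show ?thesis by (simp add: mop_def m)
qed

definition wpart :: "real \<times> real \<Rightarrow> real \<Rightarrow> formal \<Rightarrow> formal" where
  "wpart \<omega> w F \<alpha> \<beta> = (if expwt \<omega> \<alpha> \<beta> = w then F \<alpha> \<beta> else 0)"

lemma winit_elems: "P \<in> weyl_elems \<Longrightarrow> winit \<omega> P \<in> weyl_elems"
  by (auto simp: weyl_elems_def wsupp_def winit_def elim!: rev_finite_subset)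

text \<open>Modulo the submodule, \<open>F\<close> has no part of weight below \<open>w\<close>.
  Hence in degree \<open>w - ?M\<close> of \<open>P F = 0\<close> only the maximal terms of
  \<open>P\<close>, acting on the weight \<open>w\<close> part of \<open>F\<close>, remain.\<close>

lemma winit_kills_wpart:
  assumes P: "P \<in> weyl_elems" and 0: "\<And>\<alpha> \<beta>. wop P F \<alpha> \<beta> = 0"
    and low: "\<And>\<alpha> b. b < 0 \<Longrightarrow> expwt \<omega> \<alpha> (of_int b) < w \<Longrightarrow> F \<alpha> (of_int b) = 0"
    and b: "b < 0"
  shows "wop (winit \<omega> P) (wpart \<omega> w F) \<alpha> (of_int b) = 0"
proof -
  let ?G = "wpart \<omega> w F" and ?M = "Max (wt \<omega> ` wsupp P)" and ?\<beta> = "of_int b :: complex"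
  have fin: "finite (wsupp P)" using P by (simp add: weyl_elems_def)
  have sub: "wsupp (winit \<omega> P) \<subseteq> wsupp P" by (auto simp: wsupp_def winit_def)
  show ?thesis
  proof (cases "expwt \<omega> \<alpha> ?\<beta> + ?M = w")
    case True
    have "winit \<omega> P m * mop m ?G \<alpha> ?\<beta> = P m * mop m F \<alpha> ?\<beta>" if m: "m \<in> wsupp P" for m
    proof (cases "wt \<omega> m = ?M")
      case eq: True
      have "mop m ?G \<alpha> ?\<beta> = mop m F \<alpha> ?\<beta>"
        by (rule mop_cong_weight[of \<omega>]) (simp add: wpart_def eq True)
      then show ?thesis using m eq by (simp add: winit_def)
    next
      case False
      then have lt: "wt \<omega> m < ?M" using m fin by (simp add: order_less_le)
      \<comment> \<open>The part of \<open>F\<close> of weight below \<open>w\<close> lies in the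
        submodule by \<open>low\<close>, and terms of \<open>P\<close> of smaller weight see only
        this part.\<close>
      define K where "K = (\<lambda>\<alpha> \<beta>. if expwt \<omega> \<alpha> \<beta> < w then F \<alpha> \<beta> else 0)"
      have "mop m F \<alpha> ?\<beta> = mop m K \<alpha> ?\<beta>"
        by (rule mop_cong_weight[of \<omega>]) (use lt True in \<open>simp add: K_def\<close>)
      also have "\<dots> = 0"
        by (rule mop_vanish_negative_y) (use low b in \<open>auto simp: K_def\<close>)
      finally show ?thesis using False by (simp add: winit_def)
    qed
    then have "wop (winit \<omega> P) ?G \<alpha> ?\<beta> = wop P F \<alpha> ?\<beta>"
      unfolding wop_superset[OF fin sub] wop_superset[OF fin subset_refl] by (rule sum.cong[OF refl])
    then show ?thesis using 0 by simp
  next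
    case False
    \<comment> \<open>In any other degree the maximal terms of \<open>P\<close> miss the weight
      \<open>w\<close> part altogether.\<close>
    have "winit \<omega> P m * mop m ?G \<alpha> ?\<beta> = 0" for m
    proof (cases "wt \<omega> m = ?M")
      case True
      have "mop m ?G \<alpha> ?\<beta> = mop m (\<lambda>_ _. 0) \<alpha> ?\<beta>"
        by (rule mop_cong_weight[of \<omega>]) (use True False in \<open>simp add: wpart_def\<close>)
      then show ?thesis by (simp add: mop_def split: prod.splits)
    qed (simp add: winit_def)
    then show ?thesis unfolding wop_def by (intro sum.neutral ballI)
  qed
qed

text \<open>The property passes from generators to left multiples because the submodule is stable.
  Membership in \<open>weyl_elems\<close> is carried along for \<open>wop_wmult\<close>.\<close>

lemma init_ideal_kills_wpart:
  assumes I: "I \<subseteq> weyl_elems" and 0: "\<And>P \<alpha> \<beta>. P \<in> I \<Longrightarrow> wop P F \<alpha> \<beta> = 0"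
    and low: "\<And>\<alpha> b. b < 0 \<Longrightarrow> expwt \<omega> \<alpha> (of_int b) < w \<Longrightarrow> F \<alpha> (of_int b) = 0"
    and Q: "Q \<in> init_ideal \<omega> I"
  shows "Q \<in> weyl_elems \<and> (\<forall>\<alpha> b. b < 0 \<longrightarrow> wop Q (wpart \<omega> w F) \<alpha> (of_int b) = 0)"
  using Q unfolding init_ideal_def
proof (induction rule: left_ideal_gen.induct)
  case zero
  show ?case by (simp add: wzero_elems wop_wzero)
next
  case (gen g)
  then obtain P where "P \<in> I" "g = winit \<omega> P" by auto
  then show ?case using I 0 low by (auto intro!: winit_elems winit_kills_wpart)
next
  case (add P Q)
  then show ?case by (simp add: wadd_elems wop_wadd)
next
  case (lmult A P)
  then have "wop A (wop P (wpart \<omega> w F)) \<alpha> (of_int b) = 0" if "b < 0" for \<alpha> b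
    unfolding wop_def[of A] using that by (intro sum.neutral ballI) (simp add: mop_vanish_negative_y)
  with lmult show ?case by (simp add: wmult_elems wop_wmult)
qed

text \<open>For \<open>i = (n+1) q\<close> the coefficient is \<open>n choose n\<close>. For
  \<open>0 < i < q\<close> the number \<open>i/q\<close> is not an integer, so no Pochhammer factor
  vanishes.\<close>

lemma gbinomial_root_index_neq_0:
  assumes q: "0 < q" and i: "i \<in> bidx q n"
  shows "(of_real (real i / real q - real (Suc n)) + of_nat n :: complex) gchoose n \<noteq> 0"
proof (cases "i = Suc n * q")
  case True
  then have "of_real (real i / real q - real (Suc n)) + of_nat n = (of_nat n :: complex)"
    using q by (simp add: field_simps)
  then show ?thesis by (simp add: binomial_gbinomial[symmetric])
next
  case False
  then have iq: "0 < i" "i < q" using i q by (auto simp: bidx_def)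
  have z: "of_real (real i / real q - real (Suc n)) + of_nat n - of_nat n + 1 =
      (of_real (real i / real q - real n) :: complex)" by simp
  have "pochhammer (of_real (real i / real q - real n) :: complex) n \<noteq> 0"
  proof
    assume "pochhammer (of_real (real i / real q - real n) :: complex) n = 0"
    then obtain k where k: "k < n" "(of_real (real i / real q - real n) :: complex) = - of_nat k"
      by (auto simp: pochhammer_eq_0_iff)
    then have "(of_real (real i / real q - real n) :: complex) = of_real (- real k)" by simp
    then have "real i / real q - real n = - real k" by (simp only: of_real_eq_iff)
    then have "real i = real q * (real n - real k)" using q by (simp add: field_simps)
    also have "\<dots> \<ge> real q * 1" using k by (intro mult_left_mono) auto
    finally show False using iq by simp
  qed
  then show ?thesis unfolding gbinomial_pochhammer' z by simp
qed

text \<open>With \<open>t = i/q - (n+1)\<close> the series has exponents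
  \<open>(p (t+k), -i - q k)\<close>, of weight \<open>w + k (p \<omega>1 - q \<omega>2)\<close>.
  Among the terms outside the submodule \<open>k = 0\<close> has minimal weight, and there
  \<open>s\<close> has eigenvalue \<open>w\<close>.\<close>

lemma poly_root_of_init_ideal:
  assumes p: "0 < p" and q: "0 < q" and ge: "real p * \<omega>1 \<ge> real q * \<omega>2"
    and I: "I \<subseteq> weyl_elems" and kills: "\<And>P t \<alpha> \<beta>. P \<in> I \<Longrightarrow> wop P (hsol p q n t) \<alpha> \<beta> = 0"
    and i: "i \<in> bidx q n" and g: "weyl_of_poly (\<omega>1,\<omega>2) g \<in> init_ideal (\<omega>1,\<omega>2) I"
  shows "poly g (of_real (broot p q n (\<omega>1,\<omega>2) i)) = 0"
proof -
  let ?\<omega> = "(\<omega>1,\<omega>2)"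
  define \<tau> where "\<tau> = real i / real q - real (Suc n)"
  define t :: complex where "t = of_real \<tau>"
  define w where "w = broot p q n ?\<omega> i"
  have w: "w = real p * \<tau> * \<omega>1 - real i * \<omega>2" by (simp add: w_def broot_def \<tau>_def)
  have ipos: "0 < i" using i q by (auto simp: bidx_def)
  have low: "hsol p q n t \<alpha> (of_int b) = 0" if b: "b < 0" and lt: "expwt ?\<omega> \<alpha> (of_int b) < w" for \<alpha> b
  proof (rule ccontr)
    assume nz: "hsol p q n t \<alpha> (of_int b) \<noteq> 0"
    then have eq: "\<alpha> / of_nat p + of_int b / of_nat q = - of_nat (Suc n)"
      and int: "\<alpha> / of_nat p - t \<in> \<int>"
      and bin: "(\<alpha> / of_nat p + of_nat n) gchoose n \<noteq> 0"
      by (auto simp: hsol_def split: if_splits)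
    from int obtain k where k: "\<alpha> / of_nat p - t = of_int k" by (auto elim: Ints_cases)
    have \<alpha>p: "\<alpha> / of_nat p = of_real (\<tau> + real_of_int k)"
      using k by (simp add: t_def algebra_simps)
    then have \<alpha>: "\<alpha> = of_real (real p * (\<tau> + real_of_int k))" using p by (simp add: field_simps)
    have "of_real (\<tau> + real_of_int k + real_of_int b / real q) = (of_real (- real (Suc n)) :: complex)"
      using eq unfolding \<alpha>p by simp
    then have "\<tau> + real_of_int k + real_of_int b / real q = - real (Suc n)"
      by (simp only: of_real_eq_iff)
    then have "real_of_int b = - real i - real q * real_of_int k"
      using q by (simp add: \<tau>_def field_simps)
    then have "real_of_int b = real_of_int (- int i - int q * k)" by simp
    then have bk: "b = - int i - int q * k" by (simp only: of_int_eq_iff)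
    have "expwt ?\<omega> \<alpha> (of_int b) = w + real_of_int k * (real p * \<omega>1 - real q * \<omega>2)"
      by (simp add: expwt_def \<alpha> bk w algebra_simps)
    with lt have "real_of_int k * (real p * \<omega>1 - real q * \<omega>2) < 0" by simp
    then have kneg: "k < 0" using ge by (simp add: mult_less_0_iff)
    show False
    \<comment> \<open>For \<open>i = (n+1) q\<close> the coefficient is, up to sign,
      \<open>(k + n) choose n\<close>, which is zero when \<open>-n \<le> k < 0\<close>; smaller
      \<open>k\<close> would make \<open>b\<close> nonnegative. For \<open>0 < i < q\<close> already
      \<open>k < 0\<close> makes \<open>b\<close> positive.\<close>
    proof (cases "i = Suc n * q")
      case True
      then have \<tau>0: "\<tau> = 0" using q by (simp add: \<tau>_def field_simps)
      have "int q * (- (int (Suc n) + k)) < 0" using b unfolding bk True by (simp add: algebra_simps)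
      then have "int (Suc n) + k > 0" using q by (simp add: mult_less_0_iff)
      then have kn: "0 \<le> k + int n" by simp
      define j where "j = nat (k + int n)"
      have "j < n" using kn kneg by (simp add: j_def)
      have "of_real (\<tau> + real_of_int k) + of_nat n = (of_int (k + int n) :: complex)" by (simp add: \<tau>0)
      also have "\<dots> = of_nat j" using kn by (simp add: j_def)
      finally show False using bin \<open>j < n\<close> unfolding \<alpha>p
        by (simp add: binomial_gbinomial[symmetric])
    next
      case False
      then have "i < q" using i q by (auto simp: bidx_def)
      moreover have "int q * 1 \<le> int q * (- k)" using kneg by (intro mult_left_mono) auto
      ultimately show False using b bk by simp
    qed
  qed
  \<comment> \<open>Polynomials in \<open>s\<close> act diagonally, so one nonzero coefficient of
    the weight \<open>w\<close> part suffices, even if that part has further monomials.\<close>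
  have "wop (weyl_of_poly ?\<omega> g) (wpart ?\<omega> w (hsol p q n t)) (of_nat p * t) (of_int (- int i)) = 0"
  proof -
    have "weyl_of_poly ?\<omega> g \<in> weyl_elems \<and> (\<forall>\<alpha> b. b < 0 \<longrightarrow>
        wop (weyl_of_poly ?\<omega> g) (wpart ?\<omega> w (hsol p q n t)) \<alpha> (of_int b) = 0)"
      by (rule init_ideal_kills_wpart[OF I kills low g])
    moreover have "- int i < 0" using ipos by simp
    ultimately show ?thesis by blast
  qed
  then have "poly g (of_real \<omega>1 * (of_nat p * t) + of_real \<omega>2 * (- of_nat i)) *
     wpart ?\<omega> w (hsol p q n t) (of_nat p * t) (- of_nat i) = 0"
    by (simp add: wop_weyl_of_poly)
  moreover have "wpart ?\<omega> w (hsol p q n t) (of_nat p * t) (- of_nat i) \<noteq> 0"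
  proof -
    have "expwt ?\<omega> (of_nat p * t) (- of_nat i) = w" by (simp add: expwt_def w t_def)
    moreover have tp: "of_nat p * t / of_nat p = t" using p by simp
    moreover have "t + - of_nat i / of_nat q = - of_nat (Suc n)" by (simp add: t_def \<tau>_def)
    moreover have "(t + of_nat n) gchoose n \<noteq> 0"
      using gbinomial_root_index_neq_0[OF q i] by (simp add: t_def \<tau>_def)
    ultimately show ?thesis unfolding wpart_def hsol_def by simp
  qed
  moreover have "of_real \<omega>1 * (of_nat p * t) + of_real \<omega>2 * (- of_nat i) = (of_real w :: complex)"
    by (simp add: w t_def algebra_simps)
  ultimately show ?thesis by (simp add: w_def)
qed

section \<open>Monic polynomials with prescribed distinct roots, and the resulting
  b-functions\<close>

lemma lead_coeff_prod_linear:
  fixes r :: "nat \<Rightarrow> complex"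
  shows "lead_coeff (\<Prod>i\<in>J. [:- r i, 1:]) = 1"
  by (simp add: lead_coeff_prod)

lemma prod_linear_dvd_iff:
  fixes r :: "nat \<Rightarrow> complex"
  assumes "finite J" "inj_on r J"
  shows "(\<Prod>i\<in>J. [:- r i, 1:]) dvd g \<longleftrightarrow> (\<forall>i\<in>J. poly g (r i) = 0)"
  using assms
proof (induction J arbitrary: g rule: finite_induct)
  case (insert j J)
  show ?case
  proof
    assume "(\<Prod>i\<in>insert j J. [:- r i, 1:]) dvd g"
    then have "poly (\<Prod>i\<in>insert j J. [:- r i, 1:]) x = 0 \<Longrightarrow> poly g x = 0" for x
      by (auto elim!: dvdE)
    then show "\<forall>i\<in>insert j J. poly g (r i) = 0"
      using insert.hyps by (auto simp: poly_prod simp del: prod.insert)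
  next
    assume r: "\<forall>i\<in>insert j J. poly g (r i) = 0"
    then have "[:- r j, 1:] dvd g" by (simp add: poly_eq_0_iff_dvd[symmetric])
    then obtain h where h: "g = [:- r j, 1:] * h" by (elim dvdE)
    have "poly h (r i) = 0" if "i \<in> J" for i
    proof -
      have "r i \<noteq> r j" using insert.prems insert.hyps that by (metis inj_onD insertCI)
      moreover have "poly g (r i) = 0" using r that by auto
      ultimately show ?thesis by (simp add: h)
    qed
    then have "(\<Prod>i\<in>J. [:- r i, 1:]) dvd h" using insert by auto
    then show "(\<Prod>i\<in>insert j J. [:- r i, 1:]) dvd g"
      using insert.hyps unfolding h by (simp add: mult_dvd_mono del: mult_pCons_left)
  qed
qed simp

lemma rsquarefree_prod_linear:
  fixes r :: "nat \<Rightarrow> complex"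
  assumes "finite J" "inj_on r J"
  shows "rsquarefree (\<Prod>i\<in>J. [:- r i, 1:])"
  using assms
proof (induction J rule: finite_induct)
  case empty
  show ?case by (simp add: rsquarefree_roots)
next
  case (insert j J)
  let ?b = "\<Prod>i\<in>J. [:- r i, 1:]"
  have IH: "\<not> (poly ?b a = 0 \<and> poly (pderiv ?b) a = 0)" for a
    using insert by (auto simp: rsquarefree_roots)
  have d: "pderiv ([:- r j, 1:] * ?b) = [:- r j, 1:] * pderiv ?b + ?b"
    by (simp add: pderiv_mult pderiv_pCons del: mult_pCons_left mult_pCons_right)
  have ev: "poly [:- r j, 1:] a = a - r j" for a by simp
  have nz: "poly ?b (r j) \<noteq> 0" using insert by (auto simp: poly_prod)
  have "\<not> (poly ([:- r j, 1:] * ?b) a = 0 \<and> poly (pderiv ([:- r j, 1:] * ?b)) a = 0)" for a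
  proof (cases "a = r j")
    case True
    then show ?thesis unfolding d poly_add poly_mult ev using nz by simp
  next
    case False
    then show ?thesis unfolding d poly_add poly_mult ev using IH[of a] by auto
  qed
  then have "rsquarefree ([:- r j, 1:] * ?b)" unfolding rsquarefree_roots by blast
  then show ?case using insert.hyps by (simp del: mult_pCons_left)
qed

text \<open>The root is affine in \<open>i\<close> with slope
  \<open>(p \<omega>1 - q \<omega>2) / q\<close>.\<close>

lemma inj_broot:
  assumes "0 < q" "real p * \<omega>1 \<noteq> real q * \<omega>2"
  shows "inj (\<lambda>i. complex_of_real (broot p q n (\<omega>1,\<omega>2) i))"
proof (rule injI)
  fix i j
  assume "complex_of_real (broot p q n (\<omega>1,\<omega>2) i) = complex_of_real (broot p q n (\<omega>1,\<omega>2) j)"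
  then have "real q * broot p q n (\<omega>1,\<omega>2) i = real q * broot p q n (\<omega>1,\<omega>2) j" by simp
  moreover have "real q * broot p q n (\<omega>1,\<omega>2) i =
      real i * (real p * \<omega>1 - real q * \<omega>2) - real q * real p * real (Suc n) * \<omega>1" for i
    using assms(1) by (simp add: broot_def field_simps)
  ultimately have "real i * (real p * \<omega>1 - real q * \<omega>2) = real j * (real p * \<omega>1 - real q * \<omega>2)"
    by simp
  then show "i = j" using assms(2) by simp
qed

text \<open>Stated for any \<open>I\<close> with these properties, so that it applies both to the
  annihilator and to its image under \<open>wswap\<close>.\<close>

lemma is_bfunction_bpoly:
  assumes p: "0 < p" and q: "0 < q"
    and I: "I \<subseteq> weyl_elems" and kills: "\<And>P t \<alpha> \<beta>. P \<in> I \<Longrightarrow> wop P (hsol p q n t) \<alpha> \<beta> = 0"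
    and E: "euler_op p q n \<in> I" and T: "tangent_op p q \<in> I"
    and J: "real p * \<omega>1 > real q * \<omega>2 \<and> J = bidx q n \<or> real p * \<omega>1 = real q * \<omega>2 \<and> J = {Suc n * q}"
  shows "is_bfunction I (\<omega>1,\<omega>2) (bpoly p q n (\<omega>1,\<omega>2) J) \<and> rsquarefree (bpoly p q n (\<omega>1,\<omega>2) J)"
proof -
  let ?\<omega> = "(\<omega>1,\<omega>2)"
  have sub: "J \<subseteq> bidx q n" and fin: "finite J" using J by (auto simp: bidx_def)
  have inj: "inj_on (\<lambda>i. complex_of_real (broot p q n ?\<omega> i)) J"
    using J inj_broot[OF q, of p \<omega>1 \<omega>2 n] by (auto intro: inj_on_subset)
  have b: "weyl_of_poly ?\<omega> (bpoly p q n ?\<omega> J) \<in> init_ideal ?\<omega> I"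
    using J bpoly_in_init_ideal[OF p q _ E T] linear_bpoly_in_init_ideal[OF p q _ E] by blast
  have ge: "real p * \<omega>1 \<ge> real q * \<omega>2" using J by auto
  have "weyl_of_poly ?\<omega> g \<in> init_ideal ?\<omega> I \<longleftrightarrow> bpoly p q n ?\<omega> J dvd g" for g
  proof
    assume "weyl_of_poly ?\<omega> g \<in> init_ideal ?\<omega> I"
    then have "poly g (of_real (broot p q n ?\<omega> i)) = 0" if "i \<in> J" for i
      using poly_root_of_init_ideal[OF p q ge I kills] sub that by blast
    then show "bpoly p q n ?\<omega> J dvd g"
      unfolding bpoly_def using prod_linear_dvd_iff[OF fin inj] by blast
  next
    assume "bpoly p q n ?\<omega> J dvd g"
    then obtain h where "g = h * bpoly p q n ?\<omega> J" by (metis dvdE mult.commute)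
    then show "weyl_of_poly ?\<omega> g \<in> init_ideal ?\<omega> I"
      using b unfolding init_ideal_def
      by (simp add: weyl_of_poly_mult left_ideal_gen.lmult weyl_of_poly_elems)
  qed
  then show ?thesis
    using rsquarefree_prod_linear[OF fin inj] unfolding is_bfunction_def bpoly_def
    by (simp only: lead_coeff_prod_linear simp_thms)
qed

section \<open>Exchanging the variables\<close>

definition mswap :: "mono4 \<Rightarrow> mono4" where "mswap m = (case m of (a,b,c,e) \<Rightarrow> (b,a,e,c))"

definition wswap :: "weyl \<Rightarrow> weyl" where "wswap P m = P (mswap m)"

lemma mswap_mswap [simp]: "mswap (mswap m) = m"
  by (cases m) (simp add: mswap_def)

lemma wswap_wswap [simp]: "wswap (wswap P) = P"
  by (rule ext) (simp add: wswap_def)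

lemma wsupp_wswap: "wsupp (wswap P) = mswap ` wsupp P"
proof -
  have "m \<in> mswap ` wsupp P" if "P (mswap m) \<noteq> 0" for m
    using that by (intro image_eqI[of _ _ "mswap m"]) (simp_all add: wsupp_def)
  then show ?thesis by (auto simp: wsupp_def wswap_def)
qed

lemma wswap_elems: "P \<in> weyl_elems \<Longrightarrow> wswap P \<in> weyl_elems"
  by (simp add: weyl_elems_def wsupp_wswap)

lemma wop_wswap: "wop (wswap P) F \<alpha> \<beta> = wop P (\<lambda>x y. F y x) \<beta> \<alpha>"
proof -
  have "inj_on mswap (wsupp P)" by (metis inj_onI mswap_mswap)
  then have "wop (wswap P) F \<alpha> \<beta> = (\<Sum>m\<in>wsupp P. P m * mop (mswap m) F \<alpha> \<beta>)"
    unfolding wop_def wsupp_wswap by (simp add: sum.reindex wswap_def)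
  moreover have "mop (mswap m) F \<alpha> \<beta> = mop m (\<lambda>x y. F y x) \<beta> \<alpha>" for m
    by (cases m) (simp add: mswap_def mop_def)
  ultimately show ?thesis by (simp add: wop_def)
qed

lemma wswap_wmult:
  assumes "P \<in> weyl_elems" "Q \<in> weyl_elems"
  shows "wswap (wmult P Q) = wmult (wswap P) (wswap Q)"
proof (rule wop_inject)
  fix F \<alpha> \<beta>
  have "wop (wswap Q) F = (\<lambda>x y. wop Q (\<lambda>x y. F y x) y x)"
    by (intro ext) (rule wop_wswap)
  then show "wop (wswap (wmult P Q)) F \<alpha> \<beta> = wop (wmult (wswap P) (wswap Q)) F \<alpha> \<beta>"
    using assms by (simp add: wop_wswap wop_wmult wswap_elems)
qed (use assms in \<open>simp_all add: wswap_elems wmult_elems\<close>)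

lemma wswap_winit: "wswap (winit (\<omega>1,\<omega>2) P) = winit (\<omega>2,\<omega>1) (wswap P)"
proof (rule ext)
  fix m
  have wt: "wt (\<omega>2,\<omega>1) (mswap m) = wt (\<omega>1,\<omega>2) m" for m
    by (cases m) (simp add: wt_def mswap_def)
  have "wt (\<omega>2,\<omega>1) ` wsupp (wswap P) = wt (\<omega>1,\<omega>2) ` wsupp P"
    by (simp add: wsupp_wswap image_image wt)
  moreover have "m \<in> wsupp (wswap P) \<longleftrightarrow> mswap m \<in> wsupp P" by (simp add: wsupp_def wswap_def)
  ultimately show "wswap (winit (\<omega>1,\<omega>2) P) m = winit (\<omega>2,\<omega>1) (wswap P) m"
    using wt[of "mswap m"] by (simp add: wswap_def[of "winit _ _"] winit_def) (simp add: wswap_def)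
qed

lemma wswap_init_ideal:
  assumes I: "I \<subseteq> weyl_elems" and Q: "Q \<in> init_ideal (\<omega>1,\<omega>2) I"
  shows "wswap Q \<in> init_ideal (\<omega>2,\<omega>1) (wswap ` I)"
proof -
  have "Q \<in> weyl_elems \<and> wswap Q \<in> left_ideal_gen (winit (\<omega>2,\<omega>1) ` wswap ` I)"
    using Q unfolding init_ideal_def
  proof (induction rule: left_ideal_gen.induct)
    case zero
    have "wswap wzero = wzero" by (rule ext) (simp add: wswap_def wzero_def)
    then show ?case by (simp add: left_ideal_gen.zero wzero_elems)
  next
    case (gen g)
    then obtain P where "P \<in> I" "g = winit (\<omega>1,\<omega>2) P" by auto
    then show ?case using I by (auto simp: wswap_winit intro!: winit_elems left_ideal_gen.gen)
  next
    case (add P Q)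
    have "wswap (wadd P Q) = wadd (wswap P) (wswap Q)" by (rule ext) (simp add: wswap_def wadd_def)
    with add show ?case by (simp add: left_ideal_gen.add wadd_elems)
  next
    case (lmult A P)
    then show ?case by (simp add: wswap_wmult wmult_elems wswap_elems left_ideal_gen.lmult)
  qed
  then show ?thesis by (simp add: init_ideal_def)
qed

lemma wswap_weyl_of_poly: "wswap (weyl_of_poly (\<omega>1,\<omega>2) g) = weyl_of_poly (\<omega>2,\<omega>1) g"
  by (rule wop_inject) (simp_all add: wswap_elems weyl_of_poly_elems wop_wswap wop_weyl_of_poly add.commute)

text \<open>The inclusion \<open>wswap_init_ideal\<close> gives both directions because
  \<open>wswap\<close> is an involution.\<close>

lemma is_bfunction_swap:
  assumes I: "I \<subseteq> weyl_elems" and b: "is_bfunction (wswap ` I) (\<omega>2,\<omega>1) b"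
  shows "is_bfunction I (\<omega>1,\<omega>2) b"
proof -
  have "wswap ` I \<subseteq> weyl_elems" using I wswap_elems by blast
  then have "weyl_of_poly (\<omega>1,\<omega>2) g \<in> init_ideal (\<omega>1,\<omega>2) I \<longleftrightarrow>
      weyl_of_poly (\<omega>2,\<omega>1) g \<in> init_ideal (\<omega>2,\<omega>1) (wswap ` I)" for g
    using wswap_init_ideal[OF I, of "weyl_of_poly (\<omega>1,\<omega>2) g" \<omega>1 \<omega>2]
      wswap_init_ideal[of "wswap ` I" "weyl_of_poly (\<omega>2,\<omega>1) g" \<omega>2 \<omega>1]
    by (auto simp: wswap_weyl_of_poly image_image)
  then show ?thesis using b by (simp add: is_bfunction_def)
qed

text \<open>The exchange replaces \<tau> by \<open>-(n+1) - \<tau>\<close>. Reflection of the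
  binomial contributes \<open>(-1)^n\<close>; the exponentials differ by a factor that depends on
  \<tau> only modulo integers, hence is constant on the coset of \<open>-t\<close>.\<close>

lemma hsol_swap:
  "hsol q p n t \<beta> \<alpha> = exp (\<i> * of_real pi * (of_nat (Suc n) + 2 * t)) * (-1) ^ n * hsol p q n (- t) \<alpha> \<beta>"
proof -
  define \<tau> where "\<tau> = \<alpha> / of_nat p"
  show ?thesis
  proof (cases "\<tau> + \<beta> / of_nat q = - of_nat (Suc n)")
    case True
    then have \<beta>: "\<beta> / of_nat q = - of_nat (Suc n) - \<tau>" by (simp add: algebra_simps eq_neg_iff_add_eq_0)
    have int_iff: "- of_nat (Suc n) - \<tau> - t \<in> \<int> \<longleftrightarrow> \<tau> - - t \<in> \<int>"
    proof -
      have "- of_nat (Suc n) - \<tau> - t = - (\<tau> - - t) - of_nat (Suc n)" by simp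
      moreover have "- (\<tau> - - t) - of_nat (Suc n) \<in> \<int> \<longleftrightarrow> - (\<tau> - - t) \<in> \<int>"
        by (metis Ints_add Ints_diff Ints_of_nat diff_add_cancel)
      ultimately show ?thesis by (metis minus_in_Ints_iff)
    qed
    have gb: "(- of_nat (Suc n) - \<tau> + of_nat n) gchoose n = (-1) ^ n * ((\<tau> + of_nat n) gchoose n)"
    proof -
      have "- of_nat (Suc n) - \<tau> + of_nat n = - (\<tau> + 1)" by simp
      then have "(- of_nat (Suc n) - \<tau> + of_nat n) gchoose n = (- (\<tau> + 1)) gchoose n" by (simp only:)
      also have "\<dots> = (-1) ^ n * ((\<tau> + 1 + of_nat n - 1) gchoose n)" by (rule gbinomial_minus)
      finally show ?thesis by simp
    qed
    have "exp (\<i> * of_real pi * (- of_nat (Suc n) - \<tau>)) =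
        exp (\<i> * of_real pi * (of_nat (Suc n) + 2 * t)) * exp (\<i> * of_real pi * \<tau>)" if "\<tau> - - t \<in> \<int>"
    proof -
      from that obtain k where k: "\<tau> - - t = of_int k" by (auto elim: Ints_cases)
      then have \<tau>: "\<tau> = of_int k - t" by (simp add: algebra_simps)
      have "\<i> * of_real pi * (- of_nat (Suc n) - \<tau>) =
          \<i> * of_real pi * (of_nat (Suc n) + 2 * t) + \<i> * of_real pi * \<tau> +
          2 * of_int (- int (Suc n) - k) * of_real pi * \<i>"
        by (simp add: \<tau> algebra_simps)
      moreover have "exp (2 * of_int (- int (Suc n) - k) * complex_of_real pi * \<i>) = 1"
        using exp_integer_2pi[of "real_of_int (- int (Suc n) - k)"]
        by (simp only: Ints_of_int of_real_mult of_real_of_int_eq of_real_numeral)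
      ultimately show ?thesis by (simp only: exp_add mult_1_right)
    qed
    then show ?thesis
      unfolding hsol_def \<tau>_def[symmetric] unfolding \<beta> using int_iff gb
      by (simp add: mult_ac)
  next
    case False
    then show ?thesis unfolding hsol_def \<tau>_def[symmetric] by (auto simp: add.commute)
  qed
qed

lemma wop_scale: "wop P (\<lambda>\<alpha> \<beta>. c * F \<alpha> \<beta>) \<alpha> \<beta> = c * wop P F \<alpha> \<beta>"
proof -
  have "mop m (\<lambda>\<alpha> \<beta>. c * F \<alpha> \<beta>) \<alpha> \<beta> = c * mop m F \<alpha> \<beta>" for m
    by (cases m) (simp add: mop_def)
  then show ?thesis by (simp add: wop_def sum_distrib_left mult.left_commute)
qed

lemma wswap_euler_op: "wswap (euler_op p q n) = euler_op q p n"
  by (rule ext) (auto simp: wswap_def mswap_def euler_op_def)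

section \<open>The annihilator\<close>

lemma wact_superset:
  assumes "finite S" "wsupp P \<subseteq> S"
  shows "wact P g z = (\<Sum>m\<in>S. case m of (a,b,c,e) \<Rightarrow>
      P m * fst z ^ a * snd z ^ b * ((pdx ^^ c) ((pdy ^^ e) g)) z)"
  unfolding wact_def using assms by (intro sum.mono_neutral_left) (auto simp: wsupp_def)

lemma fpow_neg: "fpow p q (- int (Suc n)) (x,y) = inverse (x ^ p + y ^ q) ^ Suc n"
  unfolding fpow_def by (simp add: power_int_minus power_inverse del: power_Suc of_nat_Suc)

lemma pdx_fpow:
  assumes "x ^ p + y ^ q \<noteq> 0"
  shows "pdx (fpow p q (- int (Suc n))) (x,y) =
    - of_nat (Suc n) * (of_nat p * x ^ (p - 1)) * inverse (x ^ p + y ^ q) ^ Suc (Suc n)"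
proof -
  have "((\<lambda>x. x ^ p + y ^ q) has_field_derivative of_nat p * x ^ (p - 1)) (at x)"
    by (auto intro!: derivative_eq_intros)
  from has_field_derivative_inverse_power[OF this assms] show ?thesis
    unfolding pdx_def prod.case fpow_neg by (rule DERIV_imp_deriv)
qed

lemma pdy_fpow:
  assumes "x ^ p + y ^ q \<noteq> 0"
  shows "pdy (fpow p q (- int (Suc n))) (x,y) =
    - of_nat (Suc n) * (of_nat q * y ^ (q - 1)) * inverse (x ^ p + y ^ q) ^ Suc (Suc n)"
proof -
  have "((\<lambda>y. x ^ p + y ^ q) has_field_derivative of_nat q * y ^ (q - 1)) (at y)"
    by (auto intro!: derivative_eq_intros)
  from has_field_derivative_inverse_power[OF this assms] show ?thesis
    unfolding pdy_def prod.case fpow_neg by (rule DERIV_imp_deriv)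
qed

text \<open>\<open>f\<close> is quasi-homogeneous: \<open>q x f_x + p y f_y = p q f\<close>. The
  chain rule carries this over to the power.\<close>

lemma euler_op_Ann:
  assumes p: "0 < p" and q: "0 < q"
  shows "euler_op p q n \<in> Ann_fpow p q (- int (Suc n))"
proof -
  have "wact (euler_op p q n) (fpow p q (- int (Suc n))) (x,y) = 0" if nz: "x ^ p + y ^ q \<noteq> 0" for x y
  proof -
    define w where "w = x ^ p + y ^ q"
    define v where "v = inverse w ^ Suc (Suc n)"
    have px: "x * x ^ (p - 1) = x ^ p" "y * y ^ (q - 1) = y ^ q"
      using p q by (simp_all add: power_eq_if)
    have wv: "inverse w ^ Suc n = w * v" using nz by (simp add: v_def w_def)
    have "wact (euler_op p q n) (fpow p q (- int (Suc n))) (x,y) =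
       of_nat q * x * pdx (fpow p q (- int (Suc n))) (x,y) +
       of_nat p * y * pdy (fpow p q (- int (Suc n))) (x,y) +
       of_nat (p * q * Suc n) * fpow p q (- int (Suc n)) (x,y)"
      by (subst wact_superset[OF _ wsupp_euler_op]) (simp_all add: euler_op_def del: of_nat_Suc mult_Suc_right)
    also have "\<dots> = of_nat q * x * (- of_nat (Suc n) * (of_nat p * x ^ (p - 1)) * v) +
       of_nat p * y * (- of_nat (Suc n) * (of_nat q * y ^ (q - 1)) * v) +
       of_nat p * of_nat q * of_nat (Suc n) * (w * v)"
      unfolding pdx_fpow[OF nz] pdy_fpow[OF nz] fpow_neg w_def[symmetric] v_def[symmetric] wv of_nat_mult ..
    also have "\<dots> = of_nat p * of_nat q * of_nat (Suc n) * v * (w - x * x ^ (p - 1) - y * y ^ (q - 1))"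
      by (simp only: right_diff_distrib) (simp add: mult_ac del: of_nat_Suc)
    also have "\<dots> = 0" unfolding px by (simp add: w_def)
    finally show ?thesis .
  qed
  then show ?thesis by (auto simp: Ann_fpow_def Ann_on_def fnonzero_def euler_op_elems)
qed

text \<open>The factor \<open>c\<close> covers \<open>tangent_op p q\<close> with
  \<open>c = 1\<close> and the exchanged \<open>tangent_op q p\<close> with \<open>c = -1\<close>,
  as the exchange reverses the sign.\<close>

lemma scaled_tangent_op_Ann:
  assumes P: "P = wadd (wmono (c * of_nat q) (0,q-1,1,0)) (wmono (- c * of_nat p) (p-1,0,0,1))"
  shows "P \<in> Ann_fpow p q (- int (Suc n))"
proof -
  have sub: "wsupp P \<subseteq> {(0,q-1,1,0), (p-1,0,0,1)}"
    by (auto simp: wsupp_def P wadd_def wmono_def split: if_splits)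
  have "wact P (fpow p q (- int (Suc n))) (x,y) = 0" if nz: "x ^ p + y ^ q \<noteq> 0" for x y
  proof -
    have "wact P (fpow p q (- int (Suc n))) (x,y) =
       c * of_nat q * y ^ (q - 1) * pdx (fpow p q (- int (Suc n))) (x,y) +
       - c * of_nat p * x ^ (p - 1) * pdy (fpow p q (- int (Suc n))) (x,y)"
      by (subst wact_superset[OF _ sub]) (simp_all add: P wadd_def wmono_def del: of_nat_Suc)
    also have "\<dots> = 0"
      unfolding pdx_fpow[OF nz] pdy_fpow[OF nz] by (simp add: mult_ac del: of_nat_Suc)
    finally show ?thesis .
  qed
  moreover have "P \<in> weyl_elems" unfolding P by (intro wadd_elems wmono_elems)
  ultimately show ?thesis by (auto simp: Ann_fpow_def Ann_on_def fnonzero_def)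
qed

lemma tangent_op_Ann: "tangent_op p q \<in> Ann_fpow p q (- int (Suc n))"
  by (rule scaled_tangent_op_Ann[of _ 1]) (auto simp: tangent_op_def wadd_def wmono_def)

lemma wswap_tangent_op_Ann: "wswap (tangent_op q p) \<in> Ann_fpow p q (- int (Suc n))"
  by (rule scaled_tangent_op_Ann[of _ "-1"])
    (auto simp: fun_eq_iff wswap_def mswap_def tangent_op_def wadd_def wmono_def)

theorem mainTheorem17:
  fixes p q :: nat and l :: int and \<omega>1 \<omega>2 :: real
  assumes "0 < p" and "p \<le> q" and "l < 0" and "(\<omega>1, \<omega>2) \<noteq> (0, 0)"
  defines "b \<equiv>
    (if real p * \<omega>1 > real q * \<omega>2 then
       [:- complex_of_real (real_of_int l * real q * \<omega>2), 1:] *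
       (\<Prod>i\<in>{1..q-1}. [:- complex_of_real
           ((real_of_int l * real p + real p / real q * real i) * \<omega>1 - real i * \<omega>2), 1:])
     else if real p * \<omega>1 < real q * \<omega>2 then
       [:- complex_of_real (real_of_int l * real p * \<omega>1), 1:] *
       (\<Prod>i\<in>{1..p-1}. [:- complex_of_real
           (- real i * \<omega>1 + (real_of_int l * real q + real q / real p * real i) * \<omega>2), 1:])
     else [:- complex_of_real (real_of_int l * real p * \<omega>1), 1:])"
  shows "is_bfunction (Ann_fpow p q l) (\<omega>1, \<omega>2) b \<and> rsquarefree b"
proof -
  have p: "0 < p" and q: "0 < q" using assms by auto
  define n where "n = nat (- l - 1)"
  have l: "l = - int (Suc n)" using assms(3) by (simp add: n_def)
  let ?I = "Ann_fpow p q l"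
  have I: "?I \<subseteq> weyl_elems" by (auto simp: Ann_fpow_def Ann_on_def)
  have kills: "wop P (hsol p q n t) \<alpha> \<beta> = 0" if "P \<in> ?I" for P t \<alpha> \<beta>
    using Ann_fpow_kills_hsol[OF p q] that unfolding l by blast
  have E: "euler_op p q n \<in> ?I" unfolding l by (rule euler_op_Ann[OF p q])
  have T: "tangent_op p q \<in> ?I" unfolding l by (rule tangent_op_Ann)
  have bidx_prod: "bpoly p' q' n \<omega> (bidx q' n) = [:- complex_of_real (broot p' q' n \<omega> (Suc n * q')), 1:] *
      (\<Prod>i\<in>{1..q'-1}. [:- complex_of_real (broot p' q' n \<omega> i), 1:])" if "0 < q'" for p' q' \<omega>
  proof -
    have "Suc n * q' \<notin> {1..q'-1}" using that by auto
    then show ?thesis unfolding bpoly_def bidx_def by (subst prod.insert) auto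
  qed
  \<comment> \<open>At this index the coefficient of the first weight vanishes.\<close>
  have top: "broot p' q' n \<omega> (Suc n * q') = real_of_int l * real q' * snd \<omega>" if "0 < q'" for p' q' \<omega>
    using that by (simp add: broot_def l field_simps)
  consider (gt) "real p * \<omega>1 > real q * \<omega>2" | (lt) "real p * \<omega>1 < real q * \<omega>2"
    | (eq) "real p * \<omega>1 = real q * \<omega>2" by linarith
  then show ?thesis
  proof cases
    case gt
    have "broot p q n (\<omega>1,\<omega>2) i = (real_of_int l * real p + real p / real q * real i) * \<omega>1 - real i * \<omega>2" for i
      by (simp add: broot_def l algebra_simps)
    then have "b = bpoly p q n (\<omega>1,\<omega>2) (bidx q n)"
      using gt unfolding b_def bidx_prod[OF q] top[OF q] by simp
    then show ?thesis using is_bfunction_bpoly[OF p q I kills E T] gt by simp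
  next
    case lt
    have "broot q p n (\<omega>2,\<omega>1) i = - real i * \<omega>1 + (real_of_int l * real q + real q / real p * real i) * \<omega>2" for i
      by (simp add: broot_def l algebra_simps)
    then have b: "b = bpoly q p n (\<omega>2,\<omega>1) (bidx p n)"
      using lt unfolding b_def bidx_prod[OF p] top[OF p] by simp
    have I': "wswap ` ?I \<subseteq> weyl_elems" using I wswap_elems by blast
    \<comment> \<open>Exchanging the variables turns the series for \<open>(q,p)\<close> into a
      multiple of one for \<open>(p,q)\<close>, which the original annihilator kills.\<close>
    have kills': "wop P (hsol q p n t) \<alpha> \<beta> = 0" if P: "P \<in> wswap ` ?I" for P t \<alpha> \<beta>
    proof -
      obtain Q where "Q \<in> ?I" "P = wswap Q" using P by blast
      then show ?thesis by (simp only: wop_wswap hsol_swap[of q p] wop_scale kills mult_zero_right)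
    qed
    have "euler_op q p n \<in> wswap ` ?I" using E wswap_euler_op[of p q n] by (metis imageI)
    moreover have "tangent_op q p \<in> wswap ` ?I"
      using wswap_tangent_op_Ann[of q p n] unfolding l by (metis imageI wswap_wswap)
    ultimately have "is_bfunction (wswap ` ?I) (\<omega>2,\<omega>1) b \<and> rsquarefree b"
      unfolding b using is_bfunction_bpoly[OF q p I' kills'] lt by blast
    then show ?thesis using is_bfunction_swap[OF I] by blast
  next
    case eq
    \<comment> \<open>On the wall \<open>l p \<omega>1 = l q \<omega>2\<close>, which is the root of
      index \<open>(n+1) q\<close>.\<close>
    have r: "real_of_int l * real p * \<omega>1 = broot p q n (\<omega>1,\<omega>2) (Suc n * q)"
      using eq by (simp add: top[OF q] mult.assoc del: mult_Suc)
    have "b = bpoly p q n (\<omega>1,\<omega>2) {Suc n * q}"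
      using eq unfolding b_def bpoly_def r by (simp del: mult_Suc)
    then show ?thesis using is_bfunction_bpoly[OF p q I kills E T] eq by simp
  qed
qed

end
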